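(* Let $R\in\{\mathbb{Q},\mathbb{R}\}$, let $n\ge0$, let $T\subseteq\mathbb{R}$ be finite, and let $(X_\delta)_{\delta\in T}$ be a filtration of a directed simplicial complex $X$. Then there is an injective matching (an injective map of multisets, bars being counted with multiplicity) sending each bar in $\mathrm{Pers}_n^{\mathrm{Dir}}(X,R)$ to a bar in $\mathrm{Pers}_n(X,R)$ which contains it. Furthermore, matched bars die at the same time, that is, they have the same right endpoint.
   Context: **Directed simplicial complexes.** A directed simplicial complex $X$ on a finite vertex set $V$ is a family of tuples $(x_0,\dots,x_n)$, $n\ge 0$, of elements of $V$ such that, for $n\geq 1$, if $(x_0,\dots,x_n)\in X$ then $(x_0,\dots,\widehat{x_i},\dots,x_n)\in X$ for all $i$ ($\widehat{x_i}$ means $x_i$ is omitted). Repetitions of vertices are allowed, and every vertex belongs to at least one simplex. Tuples of length $n+1$ are called $n$-simplices. A subcomplex of $X$ is a subfamily that is itself a directed simplicial complex (possibly on a smaller vertex set). A filtration of $X$ is a family $(X_\delta)_{\delta\in T}$ of subcomplexes with $X_\delta\subseteq X_{\delta'}$ for $\delta\le\delta'$ and $X=\bigcup_{\delta\in T}X_\delta$; write $i_\delta^{\delta'}\colon X_\delta\to X_{\delta'}$ for the inclusions. **Homology and directed homology.** $C_n(X,R)$ is the free $R$-module with basis the elementary $n$-chains $[x_0,\dots,x_n]$, one for each $n$-simplex; $\partial_n[x_0,\dots,x_n]=\sum_{i=0}^n(-1)^i[x_0,\dots,\widehat{x_i},\dots,x_n]$ for $n>0$, $\partial_0=0$; $Z_n(X,R)=\ker\partial_n$,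 $B_n(X,R)=\operatorname{Im}\partial_{n+1}$, $H_n(X,R)=Z_n(X,R)/B_n(X,R)$. $Z_n^{\mathrm{Dir}}(X,R)$ is the set of cycles $\sum_i\lambda_ic_i\in Z_n(X,R)$ with each $c_i$ an elementary $n$-chain and each $\lambda_i\ge0$, and $H_n^{\mathrm{Dir}}(X,R)$ is the $R$-submodule of $H_n(X,R)$ generated by the classes of elements of $Z_n^{\mathrm{Dir}}(X,R)$. The maps $H_n(i_\delta^{\delta'})$ induced by inclusions restrict to maps $H_n^{\mathrm{Dir}}(i_\delta^{\delta'})$ on directed homology. **Persistence modules and barcodes.** The undirected and directed $n$-dimensional persistence modules of the filtration are $(\{H_n(X_\delta,R)\},\{H_n(i_\delta^{\delta'})\})_{\delta\le\delta'\in T}$ and $(\{H_n^{\mathrm{Dir}}(X_\delta,R)\},\{H_n^{\mathrm{Dir}}(i_\delta^{\delta'})\})_{\delta\le\delta'\in T}$; their barcodes are denoted $\mathrm{Pers}_n(X,R)$ and $\mathrm{Pers}_n^{\mathrm{Dir}}(X,R)$. The barcode of a persistence vector space $\{V^{\delta}\}_{\delta\in T}$, $T=\{\delta_0<\dots<\delta_m\}$, with finite-dimensional terms is defined as follows. Index it by $\mathbb{N}$ as $V^{\delta_0}\to V^{\delta_1}\to\cdots\to V^{\delta_m}\to V^{\delta_m}\to\cdots$ (identity maps after index $m$). Choose compatible bases $B_i$: the map $\nu_i$ from the $i$th to the $(i+1)$st space satisfies $\nu_i(B_i)\subseteq B_{i+1}\cup\{0\}$, $\operatorname{rank}\nu_i=|\nu_i(B_i)\cap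 B_{i+1}|$, and each element of $\operatorname{Im}(\nu_i)\cap B_{i+1}$ is the image of exactly one element of $B_i$. Let $L=\{(b,i): i>0,\ b\in B_i,\ b\notin\operatorname{Im}\nu_{i-1}\}\cup\{(b,0):b\in B_0\}$, and for $(b,i)\in L$ let $\ell(b,i)\in\mathbb{N}\cup\{+\infty\}$ be the supremum of the $j\ge i$ such that the image of $b$ in the $j$th space lies in $B_j$. The barcode is the multiset of intervals (bars) with one interval $[\delta_i,\delta_{j+1})$ for each $(b,i)\in L$ with $\ell(b,i)=j<\infty$, and one interval $[\delta_i,+\infty)$ for each $(b,i)\in L$ with $\ell(b,i)=+\infty$. It is independent of the choice of compatible bases. *)

theory Defs
  imports
    "HOL-Library.Poly_Mapping"
    "HOL-Library.Multiset"
    "HOL-Library.Extended_Real"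
    "Jordan_Normal_Form.VS_Connect"
begin

section \<open>Directed simplicial complexes and filtrations\<close>

text \<open>An $n$-simplex is a list of vertices of length $n+1$; repetitions are allowed.\<close>

definition face :: "nat \<Rightarrow> 'v list \<Rightarrow> 'v list" where
  "face i x = take i x @ drop (Suc i) x"

definition directed_simplicial_complex :: "'v set \<Rightarrow> 'v list set \<Rightarrow> bool" where
  "directed_simplicial_complex V X \<longleftrightarrow>
     finite V \<and>
     (\<forall>x\<in>X. x \<noteq> [] \<and> set x \<subseteq> V) \<and>
     (\<forall>x\<in>X. length x \<ge> 2 \<longrightarrow> (\<forall>i<length x. face i x \<in> X)) \<and>
     (\<forall>v\<in>V. \<exists>x\<in>X. v \<in> set x)"

definition simplices :: "nat \<Rightarrow> 'v list set \<Rightarrow> 'v list set" where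
  "simplices n X = {x \<in> X. length x = Suc n}"

definition subcomplex :: "'v list set \<Rightarrow> 'v list set \<Rightarrow> bool" where
  "subcomplex Y X \<longleftrightarrow> Y \<subseteq> X \<and> (\<exists>W. directed_simplicial_complex W Y)"

definition filtration :: "real set \<Rightarrow> (real \<Rightarrow> 'v list set) \<Rightarrow> 'v list set \<Rightarrow> bool" where
  "filtration T F X \<longleftrightarrow>
     (\<forall>\<delta>\<in>T. subcomplex (F \<delta>) X) \<and>
     (\<forall>\<delta>\<in>T. \<forall>\<delta>'\<in>T. \<delta> \<le> \<delta>' \<longrightarrow> F \<delta> \<subseteq> F \<delta>') \<and>
     X = (\<Union>\<delta>\<in>T. F \<delta>)"


section \<open>Homology and directed homology\<close>

text \<open>The elementary chain $[x]$ is \<^term>\<open>Poly_Mapping.single x 1\<close>.\<close>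

definition chains :: "nat \<Rightarrow> 'v list set \<Rightarrow> ('v list \<Rightarrow>\<^sub>0 'r::field) set" where
  "chains n X = {c. Poly_Mapping.keys c \<subseteq> simplices n X}"

definition boundary :: "nat \<Rightarrow> ('v list \<Rightarrow>\<^sub>0 'r::field) \<Rightarrow> ('v list \<Rightarrow>\<^sub>0 'r)" where
  "boundary n c =
     (if n = 0 then 0
      else \<Sum>x\<in>Poly_Mapping.keys c. \<Sum>i\<le>n.
             Poly_Mapping.single (face i x) ((- 1) ^ i * Poly_Mapping.lookup c x))"

definition cycles :: "nat \<Rightarrow> 'v list set \<Rightarrow> ('v list \<Rightarrow>\<^sub>0 'r::field) set" where
  "cycles n X = {c \<in> chains n X. boundary n c = 0}"

definition boundaries :: "nat \<Rightarrow> 'v list set \<Rightarrow> ('v list \<Rightarrow>\<^sub>0 'r::field) set" where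
  "boundaries n X = boundary (Suc n) ` chains (Suc n) X"

definition homology_class ::
  "nat \<Rightarrow> 'v list set \<Rightarrow> ('v list \<Rightarrow>\<^sub>0 'r::field) \<Rightarrow> ('v list \<Rightarrow>\<^sub>0 'r) set" where
  "homology_class n X z = {z + b | b. b \<in> boundaries n X}"

text \<open>
  The quotient $Z_n/B_n$, with cosets as elements. Adding the elements of $B_n$ in the scalar
  multiplication makes a difference only for the scalar $0$, where it yields the coset $B_n$. The fields
  \<^const>\<open>mult\<close> and \<^const>\<open>one\<close> are only there because the module record extends the ring record.
\<close>

definition homology ::
  "nat \<Rightarrow> 'v list set \<Rightarrow> ('r::field, ('v list \<Rightarrow>\<^sub>0 'r) set) module" where
  "homology n X =
     \<lparr> carrier = homology_class n X ` cycles n X,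
       mult = undefined,
       one = undefined,
       zero = boundaries n X,
       add = (\<lambda>P Q. {p + q | p q. p \<in> P \<and> q \<in> Q}),
       smult = (\<lambda>a P. {Poly_Mapping.map ((*) a) p + b | p b. p \<in> P \<and> b \<in> boundaries n X}) \<rparr>"

definition directed_cycles :: "nat \<Rightarrow> 'v list set \<Rightarrow> ('v list \<Rightarrow>\<^sub>0 'r::linordered_field) set" where
  "directed_cycles n X = {c \<in> cycles n X. \<forall>x. 0 \<le> Poly_Mapping.lookup c x}"

definition directed_homology ::
  "nat \<Rightarrow> 'v list set \<Rightarrow> ('r::linordered_field, ('v list \<Rightarrow>\<^sub>0 'r) set) module" where
  "directed_homology n X =
     homology n X \<lparr> carrier :=
       LinearCombinations.module.span class_ring (homology n X)
         (homology_class n X ` directed_cycles n X) \<rparr>"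

text \<open>
  The map induced by an inclusion $X \subseteq Y$: it sends the class in $X$ of a cycle to the
  class of the same cycle in $Y$.
\<close>

definition homology_map ::
  "nat \<Rightarrow> 'v list set \<Rightarrow> ('v list \<Rightarrow>\<^sub>0 'r::field) set \<Rightarrow> ('v list \<Rightarrow>\<^sub>0 'r) set" where
  "homology_map n Y P = the_elem (homology_class n Y ` P)"


section \<open>Barcodes of persistence vector spaces\<close>

text \<open>
  A persistence vector space over $T = \{\delta_0 < \dots < \delta_m\}$ is a family of spaces
  \<open>V \<delta>\<close> with maps \<open>\<phi> \<delta> \<delta>'\<close> for $\delta \le \delta'$. Its reindexing by the natural numbers is
  constant, with identity maps, from index $m$ on.
\<close>

definition param :: "real set \<Rightarrow> nat \<Rightarrow> real" where
  "param T i = sorted_list_of_set T ! min i (card T - 1)"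

definition seq_space ::
  "real set \<Rightarrow> (real \<Rightarrow> ('r, 'e) module) \<Rightarrow> nat \<Rightarrow> ('r, 'e) module" where
  "seq_space T V i = V (param T i)"

definition seq_map :: "real set \<Rightarrow> (real \<Rightarrow> real \<Rightarrow> 'e \<Rightarrow> 'e) \<Rightarrow> nat \<Rightarrow> 'e \<Rightarrow> 'e" where
  "seq_map T \<phi> i = (if i < card T - 1 then \<phi> (param T i) (param T (Suc i)) else id)"

definition rank :: "('r::field, 'e) module \<Rightarrow> ('r, 'e) module \<Rightarrow> ('e \<Rightarrow> 'e) \<Rightarrow> nat" where
  "rank U W f = vectorspace.dim class_ring (W \<lparr> carrier := f ` carrier U \<rparr>)"

definition compatible_bases ::
  "(nat \<Rightarrow> ('r::field, 'e) module) \<Rightarrow> (nat \<Rightarrow> 'e \<Rightarrow> 'e) \<Rightarrow> (nat \<Rightarrow> 'e set) \<Rightarrow> bool" where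
  "compatible_bases W \<nu> B \<longleftrightarrow>
     (\<forall>i. vectorspace.basis class_ring (W i) (B i) \<and>
          \<nu> i ` B i \<subseteq> B (Suc i) \<union> {\<zero>\<^bsub>W (Suc i)\<^esub>} \<and>
          rank (W i) (W (Suc i)) (\<nu> i) = card (\<nu> i ` B i \<inter> B (Suc i)) \<and>
          (\<forall>c \<in> \<nu> i ` carrier (W i) \<inter> B (Suc i). \<exists>!b. b \<in> B i \<and> \<nu> i b = c))"

definition births ::
  "(nat \<Rightarrow> ('r, 'e) module) \<Rightarrow> (nat \<Rightarrow> 'e \<Rightarrow> 'e) \<Rightarrow> (nat \<Rightarrow> 'e set) \<Rightarrow> ('e \<times> nat) set" where
  "births W \<nu> B =
     {(b, i). b \<in> B i \<and> (i > 0 \<longrightarrow> b \<notin> \<nu> (i - 1) ` carrier (W (i - 1)))}"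

text \<open>\<^term>\<open>fold \<nu> [i..<j]\<close> is the composite $\nu_{j-1} \circ \dots \circ \nu_i$.\<close>

definition last_index :: "(nat \<Rightarrow> 'e \<Rightarrow> 'e) \<Rightarrow> (nat \<Rightarrow> 'e set) \<Rightarrow> 'e \<times> nat \<Rightarrow> enat" where
  "last_index \<nu> B = (\<lambda>(b, i). Sup (enat ` {j. i \<le> j \<and> fold \<nu> [i..<j] b \<in> B j}))"

text \<open>
  A bar is given by its endpoints; all bars of a barcode are nonempty, so that this determines
  them as intervals.
\<close>

type_synonym bar = "real \<times> ereal"

definition bar_interval :: "bar \<Rightarrow> real set" where
  "bar_interval \<beta> = {t. fst \<beta> \<le> t \<and> ereal t < snd \<beta>}"

abbreviation right_endpoint :: "bar \<Rightarrow> ereal" where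
  "right_endpoint \<equiv> snd"

text \<open>
  If \<^term>\<open>last_index \<nu> B (b, i)\<close> is a natural number $j$, then $j < m$ because the maps are
  identities from index $m$ on.
\<close>

definition bar_of ::
  "real set \<Rightarrow> (nat \<Rightarrow> 'e \<Rightarrow> 'e) \<Rightarrow> (nat \<Rightarrow> 'e set) \<Rightarrow> 'e \<times> nat \<Rightarrow> bar" where
  "bar_of T \<nu> B = (\<lambda>(b, i).
     (param T i,
      case last_index \<nu> B (b, i) of enat j \<Rightarrow> ereal (param T (Suc j)) | \<infinity> \<Rightarrow> \<infinity>))"

text \<open>
  The barcode does not depend on the choice of compatible bases. For finite-dimensional spaces
  the set of births is finite, as required by \<^const>\<open>mset_set\<close>, because there is none after
  index $m$. The empty persistence vector space, $T = \emptyset$, has no bars.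
\<close>

definition barcode ::
  "real set \<Rightarrow> (real \<Rightarrow> ('r::field, 'e) module) \<Rightarrow> (real \<Rightarrow> real \<Rightarrow> 'e \<Rightarrow> 'e) \<Rightarrow> bar multiset" where
  "barcode T V \<phi> =
     (if T = {} then {#}
      else
        let W = seq_space T V;
            \<nu> = seq_map T \<phi>;
            B = (SOME B. compatible_bases W \<nu> B)
        in image_mset (bar_of T \<nu> B) (mset_set (births W \<nu> B)))"

definition Pers ::
  "'r::field itself \<Rightarrow> nat \<Rightarrow> real set \<Rightarrow> (real \<Rightarrow> 'v list set) \<Rightarrow> bar multiset" where
  "Pers _ n T F =
     barcode T (\<lambda>\<delta>. homology n (F \<delta>) :: ('r, ('v list \<Rightarrow>\<^sub>0 'r) set) module)
       (\<lambda>_ \<delta>'. homology_map n (F \<delta>'))"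

definition Pers_Dir ::
  "'r::linordered_field itself \<Rightarrow> nat \<Rightarrow> real set \<Rightarrow> (real \<Rightarrow> 'v list set) \<Rightarrow> bar multiset" where
  "Pers_Dir _ n T F =
     barcode T (\<lambda>\<delta>. directed_homology n (F \<delta>) :: ('r, ('v list \<Rightarrow>\<^sub>0 'r) set) module)
       (\<lambda>_ \<delta>'. homology_map n (F \<delta>'))"


section \<open>Matchings of multisets\<close>

definition copies :: "'a multiset \<Rightarrow> ('a \<times> nat) set" where
  "copies M = {(x, k). k < count M x}"

definition injective_matching ::
  "('a \<times> nat \<Rightarrow> 'b \<times> nat) \<Rightarrow> 'a multiset \<Rightarrow> 'b multiset \<Rightarrow> bool" where
  "injective_matching f M N \<longleftrightarrow> f \<in> copies M \<rightarrow> copies N \<and> inj_on f (copies M)"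

end

theory Submission
  imports Defs
begin

text \<open>
  For each parameter, directed homology is a subspace of homology, and the maps between homology groups preserve these
  subspaces: the directed persistence module is a persistence subspace of the undirected one. The
  matching exists for every persistence subspace \<open>U\<close> of a persistence vector space \<open>W\<close> of
  finite dimension, for the following reason.

  Let a bar end at stage \<open>j\<close>, that is, let its basis element be mapped to \<open>0\<close> by \<open>\<nu> j\<close>. At stage \<open>j\<close> it
  is represented by an element of the basis of \<open>W j\<close> in the kernel of \<open>\<nu> j\<close>, and it is born at stage \<open>k\<close> or
  before if and only if this element is in the image of \<open>W k\<close>. These elements form a basis of
  \<open>Im (W k \<rightarrow> W j) \<inter> ker (\<nu> j)\<close> (\<open>bij_betw_births_dying\<close>, \<open>in_span_dying\<close>), so their number is the dimension of this
  space. The corresponding space for \<open>U\<close> is contained in it. Hence, for every \<open>j\<close> and \<open>k\<close>, at most as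
  many bars of \<open>U\<close> as of \<open>W\<close> end at \<open>j\<close> and are born at stage \<open>k\<close> or before; infinite bars are counted likewise by
  \<open>Im (W k \<rightarrow> W j)\<close> at the last stage \<open>j\<close>. These inequalities are exactly what is needed to
  match the bars of \<open>U\<close> with a given death injectively to bars of \<open>W\<close> with the same death and no later birth
  (\<open>injection_below\<close>, \<open>births_injection\<close>).

  The barcode is defined from some choice of compatible bases, so the argument also needs that compatible bases
  exist (\<open>compatible_bases_exist\<close>). They are constructed from left to right, each basis being adapted to the flag
  of subspaces of vectors that die within \<open>1\<close>, \<open>2\<close>, ... steps.
\<close>

section \<open>Spans and linear independence\<close>

context vectorspace
begin

lemma lin_indpt_iff_notin_span:
  assumes "S \<subseteq> carrier V"
  shows "lin_indpt S \<longleftrightarrow> (\<forall>v\<in>S. v \<notin> span (S - {v}))"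
proof
  assume li: "lin_indpt S"
  show "\<forall>v\<in>S. v \<notin> span (S - {v})"
  proof (intro ballI notI)
    fix v assume v: "v \<in> S" "v \<in> span (S - {v})"
    have "lin_dep ((S - {v}) \<union> {v})"
      using lin_dep_iff_in_span[of "S - {v}" v] subset_li_is_li[OF li, of "S - {v}"] v assms by blast
    moreover have "(S - {v}) \<union> {v} = S" using v by blast
    ultimately show False using li by simp
  qed
next
  assume r: "\<forall>v\<in>S. v \<notin> span (S - {v})"
  show "lin_indpt S"
  proof
    assume "lin_dep S"
    then obtain A a v where A: "finite A" "A \<subseteq> S" "a \<in> A \<rightarrow> carrier K" "lincomb a A = \<zero>\<^bsub>V\<^esub>" "v \<in> A" "a v \<noteq> \<zero>\<^bsub>K\<^esub>"
      unfolding lin_dep_def by blast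
    then have "lin_dep A" unfolding lin_dep_def by blast
    then obtain u where "u \<in> A" "u \<in> span (A - {u})"
      using lindep_span[of A] A assms by blast
    moreover have "span (A - {u}) \<subseteq> span (S - {u})" using A by (intro span_is_monotone) blast
    ultimately show False using r A by blast
  qed
qed

text \<open>The set of these sums is the sum of the subspaces spanned by \<open>v\<close> and by \<open>U\<close>, hence a subspace
  containing both.\<close>

lemma in_span_insertE:
  assumes "U \<subseteq> carrier V" "v \<in> carrier V" "x \<in> span (insert v U)"
  obtains a z where "a \<in> carrier K" "z \<in> span U" "x = a \<odot>\<^bsub>V\<^esub> v \<oplus>\<^bsub>V\<^esub> z"
proof -
  have "submodule K (submodule_sum (span {v}) (span U)) V"
    using sum_is_subspace[of "span {v}" "span U"] span_is_subspace[of U] span_is_subspace[of "{v}"] assms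
    by (auto simp: subspace_def)
  moreover have "insert v U \<subseteq> submodule_sum (span {v}) (span U)"
    using in_sum_vs[of "span {v}" "span U"] in_sum_vs[of "span U" "span {v}"] vsum_comm[of "span {v}" "span U"]
      span_is_subspace[of U] span_is_subspace[of "{v}"] in_own_span[of U] in_own_span[of "{v}"] assms
    by blast
  ultimately have "x \<in> submodule_sum (span {v}) (span U)"
    using span_is_subset assms(3) by blast
  then obtain y z where yz: "y \<in> span {v}" "z \<in> span U" "x = y \<oplus>\<^bsub>V\<^esub> z"
    by (auto simp: submodule_sum_def)
  obtain a where a: "a \<in> {v} \<rightarrow> carrier K" "lincomb a {v} = y"
    using finite_in_span[of "{v}" y] yz(1) assms by auto
  have "a v \<odot>\<^bsub>V\<^esub> v \<in> carrier V" using a assms by auto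
  then have "y = a v \<odot>\<^bsub>V\<^esub> v"
    using a assms by (auto simp: lincomb_def)
  then show thesis using that[of "a v" z] a yz by auto
qed

lemma span_diff_zero:
  assumes "U \<subseteq> carrier V"
  shows "span (U - {\<zero>\<^bsub>V\<^esub>}) = span U"
proof
  show "span (U - {\<zero>\<^bsub>V\<^esub>}) \<subseteq> span U" by (intro span_is_monotone) blast
  have s: "submodule K (span (U - {\<zero>\<^bsub>V\<^esub>})) V" using assms by (intro span_is_submodule) blast
  moreover have "U \<subseteq> span (U - {\<zero>\<^bsub>V\<^esub>})"
    using in_own_span[of "U - {\<zero>\<^bsub>V\<^esub>}"] assms submodule.zero_closed[OF s] by blast
  ultimately show "span U \<subseteq> span (U - {\<zero>\<^bsub>V\<^esub>})" using span_is_subset by blast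
qed

text \<open>This is how membership in a span is turned into membership in a set when the vectors involved come from
  a basis: a basis element in the span of other basis elements (and zeros) would make the basis
  dependent.\<close>

lemma basis_element_in_span:
  assumes "lin_indpt B" "B \<subseteq> carrier V" "C \<subseteq> B \<union> {\<zero>\<^bsub>V\<^esub>}" "c \<in> B" "c \<in> span C"
  shows "c \<in> C"
proof (rule ccontr)
  assume "c \<notin> C"
  then have "C - {\<zero>\<^bsub>V\<^esub>} \<subseteq> B - {c}" using assms by blast
  moreover have "c \<in> span (C - {\<zero>\<^bsub>V\<^esub>})" using assms span_diff_zero[of C] by auto
  ultimately have "c \<in> span (B - {c})" using span_is_monotone by blast
  then show False using lin_indpt_iff_notin_span[of B] assms by blast
qed

lemma lin_indpt_insert:
  assumes "lin_indpt A" "A \<subseteq> carrier V" "v \<in> carrier V" "v \<notin> span A"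
  shows "lin_indpt (insert v A)"
proof -
  have "v \<notin> A" using in_own_span assms by blast
  then show ?thesis using lin_dep_iff_in_span[of A v] assms by auto
qed

lemma smult_cancel_span:
  assumes "U \<subseteq> carrier V" "v \<in> carrier V" "a \<in> carrier K" "a \<noteq> \<zero>\<^bsub>K\<^esub>" "a \<odot>\<^bsub>V\<^esub> v \<in> span U"
  shows "v \<in> span U"
  using mult_inverse[OF assms(3) assms(2) refl assms(4)] submodule.smult_closed[OF span_is_submodule[OF assms(1)] _ assms(5)]
    inverse_exists assms by metis

lemma submodule_neg:
  assumes "submodule K N V" "x \<in> N"
  shows "\<ominus>\<^bsub>V\<^esub> x \<in> N"
proof -
  interpret N: submodule K N V by fact
  have "(\<ominus>\<^bsub>K\<^esub> \<one>\<^bsub>K\<^esub>) \<odot>\<^bsub>V\<^esub> x \<in> N" using assms by auto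
  moreover have "x \<in> carrier V" using N.subset assms(2) by blast
  ultimately show ?thesis using smult_minus_1[of x] by metis
qed

lemma submodule_cancel:
  assumes "submodule K N V" "x \<in> carrier V" "y \<in> N" "x \<oplus>\<^bsub>V\<^esub> y \<in> N"
  shows "x \<in> N"
proof -
  interpret N: submodule K N V by fact
  have "(x \<oplus>\<^bsub>V\<^esub> y) \<oplus>\<^bsub>V\<^esub> (\<ominus>\<^bsub>V\<^esub> y) \<in> N" using assms submodule_neg[OF assms(1)] by auto
  moreover have "(x \<oplus>\<^bsub>V\<^esub> y) \<oplus>\<^bsub>V\<^esub> (\<ominus>\<^bsub>V\<^esub> y) = x"
    using assms N.subset by (simp add: a_assoc r_neg subset_iff)
  ultimately show ?thesis by simp
qed

lemma card_lin_indpt_le_card_spanning: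
  assumes "finite A" "finite B" "B \<subseteq> carrier V" "lin_indpt A" "A \<subseteq> span B"
  shows "card A \<le> card B"
  using replacement[OF assms] by auto

text \<open>Independent subsets of the subspace are independent in the whole space, so that their
  cardinalities are bounded; a maximal one is a finite basis.\<close>

lemma subspace_fin_dim:
  assumes fd: fin_dim and sub: "submodule K N V"
  shows "vectorspace.fin_dim K (V\<lparr>carrier := N\<rparr>)"
proof -
  interpret N: submodule K N V by fact
  interpret NV: vectorspace K "V\<lparr>carrier := N\<rparr>"
    using sub vectorspace_axioms by (intro subspace_is_vs) (simp add: subspace_def)
  have "\<exists>A. finite A \<and> maximal A (\<lambda>S. S \<subseteq> carrier (V\<lparr>carrier := N\<rparr>) \<and> NV.lin_indpt S)"
  proof (rule maximal_exists[where N = dim and B = "{}"])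
    fix A assume A: "A \<subseteq> carrier (V\<lparr>carrier := N\<rparr>) \<and> NV.lin_indpt A"
    then have "lin_indpt A" "A \<subseteq> carrier V" using span_li_not_depend(2)[OF _ sub, of A] N.subset by auto
    then show "finite A \<and> card A \<le> dim" using li_le_dim[OF fd] by blast
  qed (auto simp: NV.lin_dep_def)
  then show ?thesis using NV.max_li_is_basis unfolding NV.fin_dim_def NV.basis_def by blast
qed

end

context linear_map
begin

lemma submodule_preimage:
  assumes "submodule K N W"
  shows "submodule K {x \<in> carrier V. T x \<in> N} V"
proof -
  interpret N: submodule K N W by fact
  show ?thesis by unfold_locales (auto)
qed

lemma submodule_image:
  assumes "submodule K N V"
  shows "submodule K (T ` N) W"
proof -
  interpret N: submodule K N V by fact
  show ?thesis
  proof unfold_locales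
    show "T ` N \<subseteq> carrier W" using N.subset by auto
    show "\<zero>\<^bsub>W\<^esub> \<in> T ` N" using N.zero_closed T0_is_0 by (metis imageI)
    fix v w assume "v \<in> T ` N" "w \<in> T ` N"
    then obtain x y where "x \<in> N" "y \<in> N" "v = T x" "w = T y" by blast
    then show "v \<oplus>\<^bsub>W\<^esub> w \<in> T ` N"
      using N.subset N.m_closed[of x y] T_add[of x y] by (metis imageI subsetD)
  next
    fix c v assume "c \<in> carrier K" "v \<in> T ` N"
    then obtain x where "x \<in> N" "v = T x" by blast
    then show "c \<odot>\<^bsub>W\<^esub> v \<in> T ` N"
      using N.subset N.smult_closed[of c x] T_smult[of c x] \<open>c \<in> carrier K\<close> by (metis imageI subsetD)
  qed
qed

lemma image_span:
  assumes "U \<subseteq> carrier V"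
  shows "T ` V.module.span U = W.module.span (T ` U)"
proof
  have TU: "T ` U \<subseteq> carrier W" using assms by auto
  have "submodule K {x \<in> carrier V. T x \<in> W.module.span (T ` U)} V"
    by (intro submodule_preimage W.module.span_is_submodule TU)
  moreover have "U \<subseteq> {x \<in> carrier V. T x \<in> W.module.span (T ` U)}"
    using W.module.in_own_span[OF TU] assms by auto
  ultimately show "T ` V.module.span U \<subseteq> W.module.span (T ` U)" using V.module.span_is_subset by blast
  have "submodule K (T ` V.module.span U) W" by (intro submodule_image V.module.span_is_submodule assms)
  moreover have "T ` U \<subseteq> T ` V.module.span U" using V.module.in_own_span[OF assms] by blast
  ultimately show "W.module.span (T ` U) \<subseteq> T ` V.module.span U" using W.module.span_is_subset by blast
qed

text \<open>If a linear map is injective on \<open>C\<close> with independent image, then no nontrivial combination of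
  \<open>C\<close> is killed; the part in \<open>C\<close> of a kernel element of the span of \<open>C \<union> D\<close> is therefore zero. The elements of \<open>C\<close> are
  removed one at a time: a nonzero coefficient of \<open>c\<close> would put \<open>T c\<close> into the span of the images of the
  others.\<close>

lemma in_span_killed:
  assumes "finite C" "C \<subseteq> carrier V" "D \<subseteq> carrier V" "T ` D \<subseteq> {\<zero>\<^bsub>W\<^esub>}"
    and "inj_on T C" "W.module.lin_indpt (T ` C)"
    and "y \<in> V.module.span (C \<union> D)" "T y = \<zero>\<^bsub>W\<^esub>"
  shows "y \<in> V.module.span D"
  using assms
proof (induction C arbitrary: y rule: finite_induct)
  case empty
  then show ?case by simp
next
  case (insert c C)
  have cV: "c \<in> carrier V" "C \<subseteq> carrier V" using insert.prems by auto
  have CD: "C \<union> D \<subseteq> carrier V" using insert.prems by auto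
  have TC: "T ` C \<subseteq> carrier W" using cV by auto
  obtain a z where az: "a \<in> carrier K" "z \<in> V.module.span (C \<union> D)" "y = a \<odot>\<^bsub>V\<^esub> c \<oplus>\<^bsub>V\<^esub> z"
    using V.in_span_insertE[OF CD cV(1), of y] insert.prems by auto
  have zV: "z \<in> carrier V" using V.module.span_is_subset2[OF CD] az by auto
  have "T z \<in> W.module.span (T ` (C \<union> D))" using image_span[OF CD] az by blast
  also have "\<dots> \<subseteq> W.module.span (T ` C)"
  proof -
    have "T ` (C \<union> D) \<subseteq> carrier W" using CD by auto
    then have "W.module.span (T ` (C \<union> D)) = W.module.span (T ` (C \<union> D) - {\<zero>\<^bsub>W\<^esub>})" using W.span_diff_zero by simp
    also have "\<dots> \<subseteq> W.module.span (T ` C)" using insert.prems by (intro W.module.span_is_monotone) auto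
    finally show ?thesis .
  qed
  finally have Tz: "T z \<in> W.module.span (T ` C)" .
  have eq: "a \<odot>\<^bsub>W\<^esub> T c \<oplus>\<^bsub>W\<^esub> T z = \<zero>\<^bsub>W\<^esub>"
    using insert.prems az cV zV by auto
  have sub: "submodule K (W.module.span (T ` C)) W" by (intro W.module.span_is_submodule TC)
  have aT: "a \<odot>\<^bsub>W\<^esub> T c \<in> W.module.span (T ` C)"
    using W.submodule_cancel[OF sub _ Tz] eq submodule.zero_closed[OF sub] az cV by auto
  have "a = \<zero>\<^bsub>K\<^esub>"
  proof (rule ccontr)
    assume "a \<noteq> \<zero>\<^bsub>K\<^esub>"
    then have "T c \<in> W.module.span (T ` C)" using W.smult_cancel_span[OF TC _ _ _ aT] az cV by auto
    moreover have "T ` insert c C - {T c} = T ` C" using insert.prems insert.hyps by auto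
    ultimately show False
      using W.lin_indpt_iff_notin_span[of "T ` insert c C"] insert.prems cV TC by auto
  qed
  then have "y = z" using az cV zV by simp
  moreover have "W.module.lin_indpt (T ` C)"
    using W.module.subset_li_is_li[of "T ` insert c C" "T ` C"] insert.prems by auto
  ultimately show ?case using insert.IH[of z] insert.prems az by auto
qed

end


section \<open>Bases adapted to a flag\<close>

lemma (in vectorspace) add_neg_self: "x \<in> carrier V \<Longrightarrow> x \<oplus>\<^bsub>V\<^esub> (\<ominus>\<^bsub>V\<^esub> x) = \<zero>\<^bsub>V\<^esub>"
  by (simp add: r_neg)

text \<open>For an increasing family \<open>F\<close> of subspaces, an independent set is adapted if it cuts out a basis
  of the trace of its span on every \<open>F d\<close>. Below, \<open>F d\<close> consists of the vectors that die within \<open>d\<close> steps.\<close>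

definition (in vectorspace) adapted :: "(nat \<Rightarrow> 'c set) \<Rightarrow> 'c set \<Rightarrow> bool" where
  "adapted F A \<longleftrightarrow> A \<subseteq> carrier V \<and> lin_indpt A \<and> (\<forall>d. span A \<inter> F d \<subseteq> span (A \<inter> F d))"

text \<open>Any new vector taken from the lowest term \<open>F l\<close> that is not yet covered by the span works. Below \<open>l\<close> the
  term is already covered, and a combination using the new vector that lies below \<open>l\<close> lies in the old
  span; from \<open>l\<close> on, the new vector itself belongs to the term and can be subtracted.
  If all terms are covered, any vector outside the span will do.\<close>

lemma (in vectorspace) adapted_insert:
  assumes sub: "\<And>d. submodule K (F d) V" and mono: "mono F"
    and A: "adapted F A" and ngen: "span A \<noteq> carrier V"
  shows "\<exists>v \<in> carrier V - span A. adapted F (insert v A)"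
proof -
  have AV: "A \<subseteq> carrier V" and li: "lin_indpt A" and F: "\<And>d. span A \<inter> F d \<subseteq> span (A \<inter> F d)"
    using A by (auto simp: adapted_def)
  have "\<exists>v \<in> carrier V - span A. \<forall>d. F d \<subseteq> span A \<or> v \<in> F d"
  proof (cases "\<exists>d. \<not> F d \<subseteq> span A")
    case True
    define l where "l = (LEAST d. \<not> F d \<subseteq> span A)"
    have "\<not> F l \<subseteq> span A" using True unfolding l_def by (rule LeastI_ex)
    then obtain v where v: "v \<in> F l" "v \<notin> span A" by blast
    have "F d \<subseteq> span A \<or> v \<in> F d" for d
    proof (cases "d < l")
      case True
      then show ?thesis using not_less_Least unfolding l_def by blast
    next
      case False
      then show ?thesis using v monoD[OF mono, of l d] by auto
    qed
    moreover have "v \<in> carrier V" using v submodule.subset[OF sub] by blast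
    ultimately show ?thesis using v by blast
  next
    case False
    then show ?thesis using ngen span_is_subset2[OF AV] by blast
  qed
  then obtain v where v: "v \<in> carrier V" "v \<notin> span A" "\<And>d. F d \<subseteq> span A \<or> v \<in> F d" by blast
  have "x \<in> span (insert v A \<inter> F d)" if x: "x \<in> span (insert v A)" "x \<in> F d" for x d
    using v(3)[of d]
  proof
    assume "F d \<subseteq> span A"
    then have "x \<in> span (A \<inter> F d)" using F x by blast
    then show ?thesis using span_is_monotone[of "A \<inter> F d" "insert v A \<inter> F d"] by blast
  next
    assume vF: "v \<in> F d"
    interpret Fd: submodule K "F d" V by (rule sub)
    have "insert v A \<inter> F d \<subseteq> carrier V" using AV v by blast
    then interpret N: submodule K "span (insert v A \<inter> F d)" V by (rule span_is_submodule)
    obtain a z where az: "a \<in> carrier K" "z \<in> span A" "x = a \<odot>\<^bsub>V\<^esub> v \<oplus>\<^bsub>V\<^esub> z"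
      using in_span_insertE[OF AV v(1) x(1)] by blast
    have zV: "z \<in> carrier V" using az span_is_subset2[OF AV] by blast
    then have "x = z \<oplus>\<^bsub>V\<^esub> a \<odot>\<^bsub>V\<^esub> v" using az v a_comm by simp
    then have "z \<in> F d" using submodule_cancel[OF sub zV, of "a \<odot>\<^bsub>V\<^esub> v"] x vF az by auto
    then have "z \<in> span (A \<inter> F d)" using F az by blast
    then have "z \<in> span (insert v A \<inter> F d)"
      using span_is_monotone[of "A \<inter> F d" "insert v A \<inter> F d"] by blast
    moreover have "v \<in> span (insert v A \<inter> F d)"
      using in_own_span[of "insert v A \<inter> F d"] AV v vF by blast
    ultimately show ?thesis using az by auto
  qed
  then have "adapted F (insert v A)"
    using lin_indpt_insert[OF li AV v(1,2)] AV v(1) by (auto simp: adapted_def)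
  then show ?thesis using v by blast
qed

text \<open>Since adapted sets are independent, their cardinalities are bounded by the dimension, and a maximal
  one spans everything by the preceding lemma.\<close>

lemma (in vectorspace) adapted_extend:
  assumes fd: fin_dim and sub: "\<And>d. submodule K (F d) V" and mono: "mono F" and A: "adapted F A"
  shows "\<exists>B. A \<subseteq> B \<and> adapted F B \<and> span B = carrier V"
proof -
  have "\<exists>B. finite B \<and> maximal B (\<lambda>S. A \<subseteq> S \<and> adapted F S)"
    by (rule maximal_exists[where N = dim and B = A]) (use A li_le_dim[OF fd] in \<open>auto simp: adapted_def\<close>)
  then obtain B where B: "maximal B (\<lambda>S. A \<subseteq> S \<and> adapted F S)" by blast
  then have AB: "A \<subseteq> B" "adapted F B" by (auto simp: maximal_def)
  have "span B = carrier V"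
  proof (rule ccontr)
    assume "span B \<noteq> carrier V"
    then obtain v where v: "v \<in> carrier V - span B" "adapted F (insert v B)"
      using adapted_insert[OF sub mono AB(2)] by blast
    then have "insert v B = B" using B AB unfolding maximal_def by blast
    then have "v \<in> B" by blast
    then show False using v in_own_span[of B] AB by (auto simp: adapted_def)
  qed
  then show ?thesis using AB by blast
qed

text \<open>The hypotheses on \<open>F\<close> and \<open>G\<close> say that \<open>F\<close> is the preimage of \<open>G\<close>, shifted by one; in particular
  \<open>F 1\<close> is the kernel of \<open>T\<close>. As \<open>A\<close> contains a basis of the kernel, the elements outside the kernel have
  distinct, independent images. These nonzero images are again adapted because the kernel elements can be
  traced back along \<open>T\<close>.\<close>

lemma (in linear_map) adapted_image:
  assumes A: "V.adapted F A" and gen: "V.module.span A = carrier V"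
    and F: "\<And>d. F (Suc d) = {x \<in> carrier V. T x \<in> G d}" and G: "G 0 = {\<zero>\<^bsub>W\<^esub>}"
  shows "W.adapted G (T ` A - {\<zero>\<^bsub>W\<^esub>})"
    and "\<And>b b'. b \<in> A \<Longrightarrow> b' \<in> A \<Longrightarrow> T b = T b' \<Longrightarrow> T b \<noteq> \<zero>\<^bsub>W\<^esub> \<Longrightarrow> b = b'"
proof -
  have AV: "A \<subseteq> carrier V" and li: "V.module.lin_indpt A"
    and AF: "\<And>d. V.module.span A \<inter> F d \<subseteq> V.module.span (A \<inter> F d)"
    using A by (auto simp: V.adapted_def)
  have TA: "T ` A \<subseteq> carrier W" using AV by auto
  \<comment> \<open>If \<open>T b = T y\<close> with \<open>y\<close> in the span of the other elements, then \<open>b - y\<close> is in the kernel, hence in the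
      span of the kernel elements of \<open>A\<close>, which differ from \<open>b\<close>; so \<open>b\<close> depends on the others.\<close>
  have key: "T b \<notin> W.module.span (T ` (A - {b}))" if b: "b \<in> A" "T b \<noteq> \<zero>\<^bsub>W\<^esub>" for b
  proof
    assume "T b \<in> W.module.span (T ` (A - {b}))"
    moreover have Ab: "A - {b} \<subseteq> carrier V" using AV by blast
    ultimately obtain y where y: "y \<in> V.module.span (A - {b})" "T b = T y"
      using image_span[OF Ab] by blast
    have bV: "b \<in> carrier V" using b AV by blast
    have yV: "y \<in> carrier V" using y V.module.span_is_subset2[OF Ab] by blast
    have N: "submodule K (V.module.span (A - {b})) V" by (intro V.module.span_is_submodule Ab)
    have ny: "\<ominus>\<^bsub>V\<^esub> y \<in> V.module.span (A - {b})" using V.submodule_neg[OF N y(1)] .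
    have "T (b \<oplus>\<^bsub>V\<^esub> (\<ominus>\<^bsub>V\<^esub> y)) = \<zero>\<^bsub>W\<^esub>"
      using y bV yV W.add_neg_self by simp
    then have "b \<oplus>\<^bsub>V\<^esub> (\<ominus>\<^bsub>V\<^esub> y) \<in> V.module.span A \<inter> F (Suc 0)" using F G gen bV yV by auto
    then have "b \<oplus>\<^bsub>V\<^esub> (\<ominus>\<^bsub>V\<^esub> y) \<in> V.module.span (A \<inter> F (Suc 0))" using AF by blast
    also have "\<dots> \<subseteq> V.module.span (A - {b})"
      using F G b by (intro V.module.span_is_monotone) auto
    finally have "b \<in> V.module.span (A - {b})" using V.submodule_cancel[OF N bV ny] by blast
    then show False using V.lin_indpt_iff_notin_span[OF AV] li b by blast
  qed
  show inj: "b = b'" if "b \<in> A" "b' \<in> A" "T b = T b'" "T b \<noteq> \<zero>\<^bsub>W\<^esub>" for b b'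
  proof (rule ccontr)
    assume "b \<noteq> b'"
    then have "T b \<in> T ` (A - {b})" using that by blast
    moreover have "T ` (A - {b}) \<subseteq> carrier W" using AV by auto
    ultimately show False using key that W.module.in_own_span by blast
  qed
  let ?S = "T ` A - {\<zero>\<^bsub>W\<^esub>}"
  have SW: "?S \<subseteq> carrier W" using TA by blast
  have "W.module.lin_indpt ?S"
  proof (subst W.lin_indpt_iff_notin_span[OF SW], intro ballI)
    fix w assume "w \<in> ?S"
    then obtain b where b: "b \<in> A" "w = T b" "T b \<noteq> \<zero>\<^bsub>W\<^esub>" by blast
    have "?S - {w} \<subseteq> T ` (A - {b})" using b by blast
    then show "w \<notin> W.module.span (?S - {w})" using key[OF b(1,3)] b(2) W.module.span_is_monotone by blast
  qed
  moreover have "W.module.span ?S \<inter> G d \<subseteq> W.module.span (?S \<inter> G d)" for d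
  proof
    fix y assume y: "y \<in> W.module.span ?S \<inter> G d"
    then have "y \<in> W.module.span (T ` A)" using W.module.span_is_monotone[of ?S "T ` A"] by blast
    then obtain x where x: "x \<in> V.module.span A" "y = T x" using image_span[OF AV] by blast
    then have "x \<in> F (Suc d)" using F y gen by auto
    then have "x \<in> V.module.span (A \<inter> F (Suc d))" using AF x by blast
    moreover have AFd: "A \<inter> F (Suc d) \<subseteq> carrier V" using AV by blast
    ultimately have "y \<in> W.module.span (T ` (A \<inter> F (Suc d)))" using image_span[OF AFd] x by blast
    also have "\<dots> = W.module.span (T ` (A \<inter> F (Suc d)) - {\<zero>\<^bsub>W\<^esub>})"
      using W.span_diff_zero[of "T ` (A \<inter> F (Suc d))"] TA by auto
    also have "\<dots> \<subseteq> W.module.span (?S \<inter> G d)" using F by (intro W.module.span_is_monotone) auto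
    finally show "y \<in> W.module.span (?S \<inter> G d)" .
  qed
  ultimately show "W.adapted G ?S" using SW by (auto simp: W.adapted_def)
qed

lemma linear_map_comp:
  assumes "linear_map K U V f" "linear_map K V W g"
  shows "linear_map K U W (g \<circ> f)"
proof -
  interpret f: linear_map K U V f by fact
  interpret g: linear_map K V W g by fact
  show ?thesis by unfold_locales (auto simp: module_hom_def)
qed

lemma linear_map_id:
  assumes "vectorspace K V"
  shows "linear_map K V V id"
proof -
  interpret vectorspace K V by fact
  show ?thesis by unfold_locales (auto simp: module_hom_def)
qed

section \<open>Existence of compatible bases\<close>

locale persistence =
  fixes W :: "nat \<Rightarrow> ('r::field, 'e) module" and \<nu> :: "nat \<Rightarrow> 'e \<Rightarrow> 'e"
  assumes linear: "linear_map class_ring (W i) (W (Suc i)) (\<nu> i)"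
    and fin_dim: "vectorspace.fin_dim class_ring (W i)"
begin

abbreviation span_at :: "nat \<Rightarrow> 'e set \<Rightarrow> 'e set" where
  "span_at i \<equiv> LinearCombinations.module.span class_ring (W i)"

abbreviation indep_at :: "nat \<Rightarrow> 'e set \<Rightarrow> bool" where
  "indep_at i S \<equiv> \<not> LinearCombinations.module.lin_dep class_ring (W i) S"

abbreviation transition :: "nat \<Rightarrow> nat \<Rightarrow> 'e \<Rightarrow> 'e" where
  "transition i j \<equiv> fold \<nu> [i..<j]"

lemma vs: "vectorspace class_ring (W i)"
  using linear by (rule linear_map.axioms(1))

lemma linear_transition: "i \<le> j \<Longrightarrow> linear_map class_ring (W i) (W j) (transition i j)"
proof (induction j)
  case 0
  then show ?case using linear_map_id[OF vs] by (simp add: id_def)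
next
  case (Suc j)
  show ?case
  proof (cases "i = Suc j")
    case True
    then show ?thesis using linear_map_id[OF vs] by (simp add: id_def)
  next
    case False
    then have "i \<le> j" using Suc by simp
    moreover have "transition i (Suc j) = \<nu> j \<circ> transition i j" using \<open>i \<le> j\<close> by (simp add: fun_eq_iff)
    ultimately show ?thesis using linear_map_comp[OF Suc.IH linear] by metis
  qed
qed

lemma transition_transition:
  assumes "i \<le> k" "k \<le> j"
  shows "transition k j (transition i k x) = transition i j x"
proof -
  have "[i..<j] = [i..<k] @ [k..<j]" using assms by (metis le_add_diff_inverse upt_add_eq_append)
  then show ?thesis by simp
qed

text \<open>A compatible family is built from left to right. An arbitrary basis of \<open>W i\<close> does not do, since the images
  of its elements can become dependent later; the basis has to be adapted to the flag of vectors dying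
  within \<open>d\<close> steps. Its nonzero images then form an adapted independent set of the next space, which is
  extended to an adapted basis there.\<close>

theorem compatible_bases_exist: "\<exists>B. compatible_bases W \<nu> B"
proof -
  define F where "F i d = {x \<in> carrier (W i). transition i (i + d) x = \<zero>\<^bsub>W (i + d)\<^esub>}" for i d
  have subF: "submodule class_ring (F i d) (W i)" for i d
  proof -
    interpret linear_map class_ring "W i" "W (i + d)" "transition i (i + d)" by (rule linear_transition) simp
    show ?thesis using ker_is_submodule unfolding ker_def F_def .
  qed
  have FS: "F i d \<subseteq> F i (Suc d)" for i d
  proof -
    interpret linear_map class_ring "W (i + d)" "W (Suc (i + d))" "\<nu> (i + d)" by (rule linear)
    show ?thesis by (auto simp: F_def)
  qed
  have monoF: "mono (F i)" for i
    using FS by (simp add: mono_iff_le_Suc)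
  have preF: "F i (Suc d) = {x \<in> carrier (W i). \<nu> i x \<in> F (Suc i) d}" for i d
  proof -
    interpret linear_map class_ring "W i" "W (Suc i)" "\<nu> i" by (rule linear)
    show ?thesis by (auto simp: F_def upt_rec[of i] simp del: upt_Suc)
  qed
  have F0: "F i 0 = {\<zero>\<^bsub>W i\<^esub>}" for i
    using submodule.zero_closed[OF subF[of i 0]] by (auto simp: F_def)
  let ?P = "\<lambda>i A. vectorspace.adapted class_ring (W i) (F i) A \<and> span_at i A = carrier (W i)"
  let ?Q = "\<lambda>i A A'. \<nu> i ` A - {\<zero>\<^bsub>W (Suc i)\<^esub>} \<subseteq> A'"
  have "\<exists>B. \<forall>i. ?P i (B i) \<and> ?Q i (B i) (B (Suc i))"
  proof (rule dependent_nat_choice[where P = ?P and Q = ?Q])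
    interpret vectorspace class_ring "W 0" by (rule vs)
    have "adapted (F 0) {}"
      using submodule.zero_closed[OF subF] by (auto simp: adapted_def lin_dep_def)
    then show "\<exists>A. ?P 0 A" using adapted_extend[OF fin_dim subF monoF] by blast
  next
    fix A i assume A: "?P i A"
    interpret linear_map class_ring "W i" "W (Suc i)" "\<nu> i" by (rule linear)
    have "W.adapted (F (Suc i)) (\<nu> i ` A - {\<zero>\<^bsub>W (Suc i)\<^esub>})"
      using adapted_image(1)[of "F i" A "F (Suc i)"] A preF F0 by blast
    then show "\<exists>A'. ?P (Suc i) A' \<and> ?Q i A A'"
      using W.adapted_extend[OF fin_dim subF monoF] by blast
  qed
  then obtain B where "\<forall>i. ?P i (B i) \<and> ?Q i (B i) (B (Suc i))" ..
  then have B: "vectorspace.adapted class_ring (W i) (F i) (B i)"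
    "span_at i (B i) = carrier (W i)" "\<nu> i ` B i - {\<zero>\<^bsub>W (Suc i)\<^esub>} \<subseteq> B (Suc i)" for i
    by simp_all
  have basis: "vectorspace.basis class_ring (W i) (B i)" for i
    using B(1,2)[of i] by (simp add: vectorspace.adapted_def[OF vs] vectorspace.basis_def[OF vs])
  have "compatible_bases W \<nu> B"
    unfolding compatible_bases_def
  proof (intro allI conjI ballI)
    fix i
    interpret linear_map class_ring "W i" "W (Suc i)" "\<nu> i" by (rule linear)
    have Bi: "B i \<subseteq> carrier (W i)" "B (Suc i) \<subseteq> carrier (W (Suc i))" "indep_at (Suc i) (B (Suc i))"
      using basis[of i] basis[of "Suc i"] by (simp_all add: V.basis_def W.basis_def)
    show "vectorspace.basis class_ring (W i) (B i)" by (rule basis)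
    show sub: "\<nu> i ` B i \<subseteq> B (Suc i) \<union> {\<zero>\<^bsub>W (Suc i)\<^esub>}" using B(3) by blast
    have nz: "\<zero>\<^bsub>W (Suc i)\<^esub> \<notin> B (Suc i)" using W.vs_zero_lin_dep Bi by blast
    have im: "\<nu> i ` carrier (W i) = span_at (Suc i) (\<nu> i ` B i)"
      using image_span[OF Bi(1)] B(2) by simp
    let ?P = "\<nu> i ` B i \<inter> B (Suc i)"
    have P: "?P = \<nu> i ` B i - {\<zero>\<^bsub>W (Suc i)\<^esub>}" using sub nz by blast
    have PI: "?P \<subseteq> im" using Bi by (auto simp: im_def)
    interpret I: vectorspace class_ring "W (Suc i)\<lparr>carrier := im\<rparr>"
      by (rule W.subspace_is_vs) (rule imT_is_subspace)
    have "span_at (Suc i) ?P = im"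
      unfolding P using W.span_diff_zero[of "\<nu> i ` B i"] im Bi by (auto simp: im_def)
    moreover have "indep_at (Suc i) ?P" using W.module.subset_li_is_li[OF Bi(3)] by blast
    ultimately have "I.basis ?P"
      using W.module.span_li_not_depend[OF PI im_is_submodule] PI by (auto simp: I.basis_def)
    moreover have "finite ?P"
      using W.fin_dim_li_fin[OF fin_dim Bi(3,2)] by blast
    ultimately show "rank (W i) (W (Suc i)) (\<nu> i) = card ?P"
      using I.dim_basis by (simp add: rank_def im_def)
    fix c assume c: "c \<in> \<nu> i ` carrier (W i) \<inter> B (Suc i)"
    then have "c \<in> \<nu> i ` B i" using W.basis_element_in_span[OF Bi(3,2) sub] im by blast
    then obtain b where b: "b \<in> B i" "\<nu> i b = c" by blast
    have "c \<noteq> \<zero>\<^bsub>W (Suc i)\<^esub>" using c nz by blast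
    then have "b' = b" if "b' \<in> B i" "\<nu> i b' = c" for b'
      using adapted_image(2)[OF B(1,2) preF F0, of b' b] that b by simp
    then show "\<exists>!b. b \<in> B i \<and> \<nu> i b = c"
      using b by blast
  qed
  then show ?thesis by blast
qed

end


section \<open>Bars counted by dimensions\<close>

text \<open>From the index \<open>M\<close> on nothing changes, as in the reindexing of a persistence vector space over a finite
  set of parameters. Any compatible bases are considered, because the bases that define a barcode are an
  arbitrary choice.\<close>

locale persistence_with_bases = persistence W \<nu> for W :: "nat \<Rightarrow> ('r::field, 'e) module" and \<nu> +
  fixes B :: "nat \<Rightarrow> 'e set" and M :: nat
  assumes compat: "compatible_bases W \<nu> B"
    and stationary: "M \<le> j \<Longrightarrow> W (Suc j) = W j" "M \<le> j \<Longrightarrow> \<nu> j = id"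
begin

abbreviation zero_at :: "nat \<Rightarrow> 'e" where
  "zero_at i \<equiv> \<zero>\<^bsub>W i\<^esub>"

lemma basis_at: "B i \<subseteq> carrier (W i)" "indep_at i (B i)" "span_at i (B i) = carrier (W i)"
proof -
  have "vectorspace.basis class_ring (W i) (B i)" using compat by (simp add: compatible_bases_def)
  then show "B i \<subseteq> carrier (W i)" "indep_at i (B i)" "span_at i (B i) = carrier (W i)"
    by (simp_all add: vectorspace.basis_def[OF vs])
qed

lemma finite_basis: "finite (B i)"
  using vectorspace.fin_dim_li_fin[OF vs fin_dim basis_at(2,1)] .

lemma zero_notin_basis: "zero_at i \<notin> B i"
  using vectorspace.vs_zero_lin_dep[OF vs basis_at(1,2)] .

lemma step_mem: "b \<in> B i \<Longrightarrow> \<nu> i b \<in> B (Suc i) \<or> \<nu> i b = zero_at (Suc i)"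
  using compat unfolding compatible_bases_def by blast

lemma transition_zero: "i \<le> j \<Longrightarrow> transition i j (zero_at i) = zero_at j"
proof -
  assume "i \<le> j"
  then interpret linear_map class_ring "W i" "W j" "transition i j" by (rule linear_transition)
  show ?thesis by (rule f0_is_0)
qed

lemma transition_Suc: "i \<le> j \<Longrightarrow> transition i (Suc j) x = \<nu> j (transition i j x)"
  by simp

lemma transition_mem: "i \<le> j \<Longrightarrow> b \<in> B i \<Longrightarrow> transition i j b \<in> B j \<or> transition i j b = zero_at j"
proof (induction j rule: dec_induct)
  case (step j)
  have "\<nu> j (zero_at j) = zero_at (Suc j)" using transition_zero[of j "Suc j"] by simp
  then show ?case using step step_mem[of "transition i j b" j] by (auto simp: transition_Suc simp del: upt_Suc)
qed simp

lemma transition_mem_between: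
  assumes "i \<le> l" "l \<le> j" "b \<in> B i" "transition i j b \<in> B j"
  shows "transition i l b \<in> B l"
proof (rule ccontr)
  assume "transition i l b \<notin> B l"
  then have "transition i l b = zero_at l" using transition_mem assms by blast
  then have "transition i j b = zero_at j" using transition_transition[of i l j b] transition_zero[of l j] assms by simp
  then show False using assms zero_notin_basis by simp
qed

lemma step_inj:
  assumes "b \<in> B i" "b' \<in> B i" "\<nu> i b = \<nu> i b'" "\<nu> i b \<in> B (Suc i)"
  shows "b = b'"
proof -
  have "\<nu> i b \<in> \<nu> i ` carrier (W i) \<inter> B (Suc i)" using assms basis_at(1)[of i] by blast
  then have "\<exists>!a. a \<in> B i \<and> \<nu> i a = \<nu> i b" using compat unfolding compatible_bases_def by blast
  then show ?thesis using assms by metis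
qed

lemma transition_inj:
  "i \<le> j \<Longrightarrow> b \<in> B i \<Longrightarrow> b' \<in> B i \<Longrightarrow> transition i j b = transition i j b' \<Longrightarrow> transition i j b \<in> B j \<Longrightarrow> b = b'"
proof (induction j rule: dec_induct)
  case (step j)
  have m: "transition i j b \<in> B j" "transition i j b' \<in> B j"
    using transition_mem_between[of i j "Suc j"] step by auto
  have "transition i j b = transition i j b'"
    using step_inj[OF m] step by (simp add: transition_Suc del: upt_Suc)
  then show ?case using step m by blast
qed simp

lemma image_transition:
  assumes "k \<le> j"
  shows "transition k j ` carrier (W k) = span_at j (transition k j ` B k)"
proof -
  interpret linear_map class_ring "W k" "W j" "transition k j" using assms by (rule linear_transition)
  show ?thesis using image_span[OF basis_at(1)[of k]] basis_at(3)[of k] by simp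
qed

text \<open>The nonzero images of \<open>B k\<close> span the image of \<open>W k\<close> and are themselves elements of the basis \<open>B j\<close>, so an element of
  \<open>B j\<close> in this image is one of them.\<close>

lemma basis_preimage:
  assumes "k \<le> j" "c \<in> B j" "c \<in> transition k j ` carrier (W k)"
  obtains b where "b \<in> B k" "transition k j b = c"
proof -
  interpret vectorspace class_ring "W j" by (rule vs)
  have "transition k j ` B k \<subseteq> B j \<union> {zero_at j}" using transition_mem assms by blast
  then have "c \<in> transition k j ` B k"
    using basis_element_in_span[OF basis_at(2,1)] image_transition assms by blast
  then show thesis using that by blast
qed

lemma birth_exists:
  "b \<in> B k \<Longrightarrow> \<exists>(b', i) \<in> births W \<nu> B. i \<le> k \<and> transition i k b' = b"
proof (induction k arbitrary: b)
  case 0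
  then show ?case by (intro bexI[of _ "(b, 0)"]) (auto simp: births_def)
next
  case (Suc k)
  show ?case
  proof (cases "b \<in> \<nu> k ` carrier (W k)")
    case True
    then obtain c where c: "c \<in> B k" "\<nu> k c = b" using basis_preimage[of k "Suc k" b] Suc by auto
    then obtain b' i where "(b', i) \<in> births W \<nu> B" "i \<le> k" "transition i k b' = c" using Suc.IH by blast
    then show ?thesis using c by (intro bexI[of _ "(b', i)"]) auto
  next
    case False
    then show ?thesis using Suc by (intro bexI[of _ "(b, Suc k)"]) (auto simp: births_def)
  qed
qed

text \<open>If two bars met, the older one would pass through the birth of the younger one, by injectivity of the
  transition maps on basis elements that survive. But a birth is not in the image of the preceding space.\<close>

lemma births_inj_le:
  assumes b: "(b, i) \<in> births W \<nu> B" "(b', i') \<in> births W \<nu> B"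
    and le: "i \<le> i'" "i' \<le> j" and eq: "transition i j b = transition i' j b'" "transition i j b \<in> B j"
  shows "(b, i) = (b', i')"
proof -
  have bB: "b \<in> B i" "b' \<in> B i'" using b by (auto simp: births_def)
  have "transition i i' b \<in> B i'" using transition_mem_between[of i i' j b] bB le eq by simp
  moreover have "transition i' j (transition i i' b) = transition i' j b'" using transition_transition[of i i' j b] le eq by simp
  ultimately have e: "transition i i' b = b'" using transition_inj[of i' j "transition i i' b" b'] bB le eq by simp
  have "i = i'"
  proof (rule ccontr)
    assume "i \<noteq> i'"
    then obtain l where l: "i' = Suc l" "i \<le> l" using le by (cases i') auto
    interpret linear_map class_ring "W i" "W l" "transition i l" using l(2) by (rule linear_transition)
    have "transition i l b \<in> carrier (W l)" using bB basis_at(1) by blast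
    then have "b' \<in> \<nu> l ` carrier (W l)" using e l by auto
    then show False using b l by (auto simp: births_def)
  qed
  then show ?thesis using e by simp
qed

lemma births_inj:
  assumes b: "(b, i) \<in> births W \<nu> B" "(b', i') \<in> births W \<nu> B"
    and le: "i \<le> j" "i' \<le> j" and eq: "transition i j b = transition i' j b'" "transition i j b \<in> B j"
  shows "(b, i) = (b', i')"
proof (cases "i \<le> i'")
  case True
  then show ?thesis by (rule births_inj_le[OF b _ le(2) eq])
next
  case False
  then have "i' \<le> i" by simp
  moreover have "transition i' j b' \<in> B j" using eq by simp
  ultimately show ?thesis using births_inj_le[OF b(2,1) _ le(1) eq(1)[symmetric]] by simp
qed

text \<open>The basis elements of stage \<open>j\<close> through which the bars ending at this stage pass. The flag \<open>e\<close> is set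
  for bars with a finite right endpoint; for infinite bars, \<open>j\<close> is the last stage and every
  basis element counts.\<close>

definition dying :: "bool \<Rightarrow> nat \<Rightarrow> 'e set" where
  "dying e j = {c \<in> B j. e \<longrightarrow> \<nu> j c = zero_at (Suc j)}"

text \<open>A bar is determined by the basis element that it passes through at stage \<open>j\<close>, and it is born at
  stage \<open>k\<close> or before if and only if this element comes from \<open>W k\<close>.\<close>

lemma bij_betw_births_dying:
  assumes "k \<le> j"
  shows "bij_betw (\<lambda>(b, i). transition i j b) {(b, i) \<in> births W \<nu> B. i \<le> k \<and> transition i j b \<in> dying e j}
           (dying e j \<inter> transition k j ` carrier (W k))"
proof -
  let ?L = "{(b, i) \<in> births W \<nu> B. i \<le> k \<and> transition i j b \<in> dying e j}"
  have "inj_on (\<lambda>(b, i). transition i j b) ?L"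
  proof (rule inj_onI, clarify)
    fix b i b' i'
    assume "(b, i) \<in> births W \<nu> B" "(b', i') \<in> births W \<nu> B" "i \<le> k" "i' \<le> k"
      "transition i j b = transition i' j b'" "transition i j b \<in> dying e j"
    then show "b = b' \<and> i = i'"
      using births_inj[of b i b' i' j] assms by (auto simp: dying_def)
  qed
  moreover have "(\<lambda>(b, i). transition i j b) ` ?L = dying e j \<inter> transition k j ` carrier (W k)"
  proof (intro equalityI subsetI)
    fix c assume "c \<in> (\<lambda>(b, i). transition i j b) ` ?L"
    then obtain b i where b: "(b, i) \<in> births W \<nu> B" "i \<le> k" "transition i j b \<in> dying e j" "c = transition i j b"
      by auto
    interpret linear_map class_ring "W i" "W k" "transition i k" using b(2) by (rule linear_transition)
    have "b \<in> carrier (W i)" using b basis_at(1)[of i] by (auto simp: births_def)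
    then have "transition i k b \<in> carrier (W k)" by (rule f_im)
    moreover have "c = transition k j (transition i k b)" using transition_transition b assms by simp
    ultimately show "c \<in> dying e j \<inter> transition k j ` carrier (W k)" using b(3,4) by auto
  next
    fix c assume c: "c \<in> dying e j \<inter> transition k j ` carrier (W k)"
    then obtain a where a: "a \<in> B k" "transition k j a = c"
      using basis_preimage[OF assms, of c] by (auto simp: dying_def)
    then obtain b i where "(b, i) \<in> births W \<nu> B" "i \<le> k" "transition i k b = a"
      using birth_exists by blast
    then have "(b, i) \<in> ?L" "c = transition i j b" using c a transition_transition[of i k j b] assms by auto
    then show "c \<in> (\<lambda>(b, i). transition i j b) ` ?L" by (auto intro!: image_eqI[of _ _ "(b, i)"])
  qed
  ultimately show ?thesis by (simp add: bij_betw_def)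
qed

text \<open>Together with independence, this says that the elements counted by the preceding lemma form a basis of
  \<open>Im (W k \<rightarrow> W j)\<close>, respectively of \<open>Im (W k \<rightarrow> W j) \<inter> ker (\<nu> j)\<close> if \<open>e\<close> holds. So the number of bars ending at
  a given point and born at stage \<open>k\<close> or before is the dimension of a space that does not depend on the bases and grows
  with the persistence vector space.\<close>

lemma in_span_dying:
  assumes kj: "k \<le> j" and y: "y \<in> transition k j ` carrier (W k)" "e \<Longrightarrow> \<nu> j y = zero_at (Suc j)"
  shows "y \<in> span_at j (dying e j \<inter> transition k j ` carrier (W k))"
proof -
  interpret linear_map class_ring "W j" "W (Suc j)" "\<nu> j" by (rule linear)
  let ?I = "transition k j ` carrier (W k)"
  have "transition k j ` B k \<subseteq> B j \<union> {zero_at j}" using transition_mem kj by blast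
  then have sub: "transition k j ` B k - {zero_at j} \<subseteq> B j \<inter> ?I" using basis_at(1)[of k] by blast
  have "transition k j ` B k \<subseteq> carrier (W j)" using \<open>transition k j ` B k \<subseteq> B j \<union> {zero_at j}\<close> basis_at(1)[of j] by auto
  then have "y \<in> span_at j (transition k j ` B k - {zero_at j})"
    using V.span_diff_zero[of "transition k j ` B k"] image_transition[OF kj] y by simp
  then have yI: "y \<in> span_at j (B j \<inter> ?I)" using V.module.span_is_monotone[OF sub] by blast
  show ?thesis
  proof (cases e)
    case False
    then show ?thesis using yI by (simp add: dying_def)
  next
    case True
    let ?D = "dying True j \<inter> ?I" and ?C = "B j \<inter> ?I - dying True j"
    have DC: "B j \<inter> ?I = ?C \<union> ?D" by (auto simp: dying_def)
    have C: "\<nu> j c \<in> B (Suc j)" if "c \<in> ?C" for c using that step_mem by (auto simp: dying_def)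
    have "inj_on (\<nu> j) ?C"
    proof (rule inj_onI)
      fix b b' assume "b \<in> ?C" "b' \<in> ?C" "\<nu> j b = \<nu> j b'"
      then show "b = b'" using transition_inj[of j "Suc j" b b'] C[of b] by auto
    qed
    moreover have "indep_at (Suc j) (\<nu> j ` ?C)"
      using W.module.subset_li_is_li[OF basis_at(2)[of "Suc j"], of "\<nu> j ` ?C"] C by blast
    moreover have "?C \<subseteq> carrier (W j)" "?D \<subseteq> carrier (W j)" using basis_at(1)[of j] by (auto simp: dying_def)
    moreover have "\<nu> j ` ?D \<subseteq> {zero_at (Suc j)}" by (auto simp: dying_def)
    moreover have "y \<in> span_at j (?C \<union> ?D)" using yI DC by simp
    moreover have "finite ?C" using finite_basis[of j] by blast
    ultimately have "y \<in> span_at j ?D" using in_span_killed[of ?C ?D y] y(2)[OF True] by simp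
    then show ?thesis using True by simp
  qed
qed

lemma births_le: "(b, i) \<in> births W \<nu> B \<Longrightarrow> i \<le> M"
proof (rule ccontr)
  assume b: "(b, i) \<in> births W \<nu> B" and "\<not> i \<le> M"
  then obtain l where "i = Suc l" "M \<le> l" by (cases i) auto
  then show False using b basis_at(1)[of i] stationary[of l] by (auto simp: births_def)
qed

lemma finite_births: "finite (births W \<nu> B)"
proof (rule finite_subset)
  show "births W \<nu> B \<subseteq> (\<Union>i\<le>M. B i \<times> {i})" using births_le by (fastforce simp: births_def)
  show "finite (\<Union>i\<le>M. B i \<times> {i})" using finite_basis by simp
qed

lemma last_index_eqI:
  assumes "i \<le> j" "transition i j b \<in> B j" "\<And>l. i \<le> l \<Longrightarrow> transition i l b \<in> B l \<Longrightarrow> l \<le> j"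
  shows "last_index \<nu> B (b, i) = enat j"
  unfolding last_index_def prod.case
proof (rule cSup_eq_maximum)
  show "enat j \<in> enat ` {j. i \<le> j \<and> transition i j b \<in> B j}" using assms(1,2) by simp
  show "x \<le> enat j" if "x \<in> enat ` {j. i \<le> j \<and> transition i j b \<in> B j}" for x
    using that assms(3) by (elim imageE) simp
qed

text \<open>The stages at which a basis element is still alive form an interval starting at its birth, because zero is never
  mapped to a basis element.\<close>

lemma last_index_cases:
  assumes "b \<in> B i"
  obtains (fin) j where "last_index \<nu> B (b, i) = enat j" "i \<le> j" "transition i j b \<in> B j"
      "\<And>l. i \<le> l \<Longrightarrow> transition i l b \<in> B l \<Longrightarrow> l \<le> j"
  | (inf) "last_index \<nu> B (b, i) = \<infinity>" "\<And>l. i \<le> l \<Longrightarrow> transition i l b \<in> B l"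
proof -
  let ?S = "{j. i \<le> j \<and> transition i j b \<in> B j}"
  have iS: "i \<in> ?S" using assms by simp
  show thesis
  proof (cases "finite ?S")
    case True
    then have "Max ?S \<in> ?S" "\<And>l. l \<in> ?S \<Longrightarrow> l \<le> Max ?S" using iS Max_in[of ?S] Max_ge[of ?S] by blast+
    then show thesis using fin[of "Max ?S"] last_index_eqI[of i "Max ?S" b] by auto
  next
    case False
    then have "infinite (enat ` ?S)" by (subst finite_image_iff) (simp_all add: inj_on_def)
    then have "last_index \<nu> B (b, i) = \<infinity>"
      using iS by (auto simp: last_index_def Sup_enat_def)
    moreover have "transition i l b \<in> B l" if "i \<le> l" for l
    proof -
      obtain j where "l \<le> j" "j \<in> ?S" using False unfolding infinite_nat_iff_unbounded_le by blast
      then show ?thesis using transition_mem_between[of i l j b] assms that by simp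
    qed
    ultimately show thesis using inf by blast
  qed
qed

lemma last_index_eq_enat_iff:
  assumes b: "b \<in> B i"
  shows "last_index \<nu> B (b, i) = enat j \<longleftrightarrow> i \<le> j \<and> transition i j b \<in> dying True j"
proof
  assume "last_index \<nu> B (b, i) = enat j"
  with b have j: "i \<le> j" "transition i j b \<in> B j" "\<And>l. i \<le> l \<Longrightarrow> transition i l b \<in> B l \<Longrightarrow> l \<le> j"
    by (cases rule: last_index_cases; simp)+
  then have "transition i (Suc j) b \<notin> B (Suc j)" by (metis Suc_n_not_le_n le_SucI)
  then show "i \<le> j \<and> transition i j b \<in> dying True j"
    using j step_mem[OF j(2)] by (simp add: dying_def)
next
  assume j: "i \<le> j \<and> transition i j b \<in> dying True j"
  show "last_index \<nu> B (b, i) = enat j"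
  proof (rule last_index_eqI)
    fix l assume l: "i \<le> l" "transition i l b \<in> B l"
    show "l \<le> j"
    proof (rule ccontr)
      assume "\<not> l \<le> j"
      then have "transition i (Suc j) b \<in> B (Suc j)" using transition_mem_between[of i "Suc j" l b] b j l by simp
      then show False using j zero_notin_basis[of "Suc j"] by (simp add: dying_def)
    qed
  qed (use j in \<open>auto simp: dying_def\<close>)
qed

lemma last_index_eq_infinity_iff:
  assumes b: "b \<in> B i" and "i \<le> M"
  shows "last_index \<nu> B (b, i) = \<infinity> \<longleftrightarrow> transition i M b \<in> B M"
proof -
  \<comment> \<open>Only nonzeroness has to be propagated, since the maps are identities here.\<close>
  have "transition i l b \<in> B l" if "transition i M b \<in> B M" "M \<le> l" for l
    using that(2)
  proof (induction l rule: dec_induct)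
    case (step l)
    then have "transition i (Suc l) b = transition i l b" using stationary(2)[of l] assms by simp
    moreover have "zero_at (Suc l) \<noteq> transition i l b" using stationary(1)[of l] step zero_notin_basis[of l] by auto
    ultimately show ?case using step step_mem[of "transition i l b" l] stationary(2)[of l] by auto
  qed (rule that(1))
  note stays = this
  show ?thesis
  proof
    assume "last_index \<nu> B (b, i) = \<infinity>"
    with b show "transition i M b \<in> B M" using \<open>i \<le> M\<close> by (cases rule: last_index_cases) auto
  next
    assume t: "transition i M b \<in> B M"
    from b show "last_index \<nu> B (b, i) = \<infinity>"
    proof (cases rule: last_index_cases)
      case (fin j)
      have "i \<le> max M (Suc j)" using \<open>i \<le> M\<close> by simp
      then have "max M (Suc j) \<le> j" by (rule fin(4)) (rule stays[OF t max.cobounded1])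
      then show ?thesis by simp
    qed
  qed
qed

text \<open>Infinite bars are counted at stage \<open>M\<close>, where all of them are alive and from which no bar ends any more.\<close>

definition last_stage :: "enat \<Rightarrow> nat" where
  "last_stage d = (case d of enat j \<Rightarrow> j | \<infinity> \<Rightarrow> M)"

lemma card_births_last_index:
  defines "l \<equiv> last_stage"
  shows "card {x \<in> births W \<nu> B. last_index \<nu> B x = d \<and> snd x \<le> k} =
         card (dying (d \<noteq> \<infinity>) (l d) \<inter> transition (min k (l d)) (l d) ` carrier (W (min k (l d))))"
proof -
  have "last_index \<nu> B (b, i) = d \<longleftrightarrow> i \<le> l d \<and> transition i (l d) b \<in> dying (d \<noteq> \<infinity>) (l d)"
    if "(b, i) \<in> births W \<nu> B" for b i
  proof (cases d)
    case (enat j)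
    then show ?thesis using last_index_eq_enat_iff[of b i j] that
      by (auto simp: l_def last_stage_def births_def)
  next
    case infinity
    then show ?thesis using last_index_eq_infinity_iff[of b i] births_le[OF that] that
      by (auto simp: l_def last_stage_def births_def dying_def)
  qed
  then have "{x \<in> births W \<nu> B. last_index \<nu> B x = d \<and> snd x \<le> k} =
      {(b, i) \<in> births W \<nu> B. i \<le> min k (l d) \<and> transition i (l d) b \<in> dying (d \<noteq> \<infinity>) (l d)}"
    by auto
  then show ?thesis
    using bij_betw_same_card[OF bij_betw_births_dying[of "min k (l d)" "l d" "d \<noteq> \<infinity>"]] by simp
qed

end

section \<open>Comparing a persistence vector space with a subobject\<close>

text \<open>Hall's condition in the nested case: the candidates for \<open>a\<close> are the \<open>c\<close> with \<open>q c \<le> p a\<close>. Assigning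
  partners in the order of increasing \<open>p\<close>, fewer than \<open>card {c. q c \<le> p a}\<close> elements are taken when the
  turn of \<open>a\<close> comes.\<close>

lemma injection_below:
  fixes p :: "'a \<Rightarrow> nat" and q :: "'b \<Rightarrow> nat"
  assumes "finite A" "finite C"
    and "\<And>k. card {a \<in> A. p a \<le> k} \<le> card {c \<in> C. q c \<le> k}"
  shows "\<exists>g. inj_on g A \<and> g \<in> A \<rightarrow> C \<and> (\<forall>a\<in>A. q (g a) \<le> p a)"
  using assms
proof (induction A rule: finite_ranking_induct[where f = p])
  case empty
  then show ?case by auto
next
  case (insert a A)
  show ?case
  proof (cases "a \<in> A")
    case True
    then show ?thesis using insert by (simp add: insert_absorb)
  next
    case False
    have "card {x \<in> A. p x \<le> k} \<le> card {c \<in> C. q c \<le> k}" for k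
      using insert.prems(2)[of k] card_mono[of "{x \<in> insert a A. p x \<le> k}" "{x \<in> A. p x \<le> k}"] insert.hyps
      by fastforce
    then obtain g where g: "inj_on g A" "g \<in> A \<rightarrow> C" "\<forall>x\<in>A. q (g x) \<le> p x"
      using insert.IH insert.prems(1) by blast
    have "{x \<in> insert a A. p x \<le> p a} = insert a A" using insert.hyps by auto
    then have "card (g ` A) < card {c \<in> C. q c \<le> p a}"
      using insert.prems(2)[of "p a"] insert.hyps card_image[OF g(1)] False by simp
    then have "\<not> {c \<in> C. q c \<le> p a} \<subseteq> g ` A"
      using card_mono[OF finite_imageI[OF insert.hyps(1)], of "{c \<in> C. q c \<le> p a}" g] by (meson not_le)
    then obtain c where c: "c \<in> C" "q c \<le> p a" "c \<notin> g ` A" by blast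
    show ?thesis
    proof (intro exI[of _ "g(a := c)"] conjI)
      show "inj_on (g(a := c)) (insert a A)"
        using inj_on_fun_updI[OF g(1) c(3), of a] c(3) False by (auto simp: fun_upd_image)
      show "g(a := c) \<in> insert a A \<rightarrow> C" "\<forall>x\<in>insert a A. q ((g(a := c)) x) \<le> p x"
        using g c by auto
    qed
  qed
qed

text \<open>For a fixed last index, the births at stage \<open>k\<close> or before are counted by dimensions of images intersected with
  kernels, and those of the subobject are subspaces of those of the whole. So the subobject has at most
  as many bars with this death and birth at stage \<open>k\<close> or before, for every \<open>k\<close>. This suffices to match the bars with
  this death injectively to bars that are not younger; the matchings for different deaths do not interfere.\<close>

theorem births_injection:
  assumes W: "persistence_with_bases W \<nu> B M"
    and U: "persistence_with_bases U \<nu> B' M"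
    and sub: "\<And>i. submodule class_ring (S i) (W i)" "\<And>i. U i = W i\<lparr>carrier := S i\<rparr>"
  shows "\<exists>g. inj_on g (births U \<nu> B') \<and> g \<in> births U \<nu> B' \<rightarrow> births W \<nu> B \<and>
    (\<forall>x \<in> births U \<nu> B'. last_index \<nu> B (g x) = last_index \<nu> B' x \<and> snd (g x) \<le> snd x)"
proof -
  interpret W: persistence_with_bases W \<nu> B M by (rule W)
  interpret U: persistence_with_bases U \<nu> B' M by (rule U)
  have card: "card (U.dying e j \<inter> U.transition k j ` carrier (U k)) \<le> card (W.dying e j \<inter> W.transition k j ` carrier (W k))"
    (is "card ?A \<le> card ?C") if "k \<le> j" for e k j
  proof -
    interpret Wj: vectorspace class_ring "W j" by (rule W.vs)
    have US: "U.transition k j ` carrier (U k) \<subseteq> W.transition k j ` carrier (W k)"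
      using submodule.subset[OF sub(1)[of k]] sub(2)[of k] by auto
    have AS: "?A \<subseteq> S j" using U.basis_at(1)[of j] sub(2)[of j] by (auto simp: U.dying_def)
    have "finite ?A" using U.finite_basis[of j] by (auto simp: U.dying_def)
    moreover have "finite ?C" using W.finite_basis[of j] by (auto simp: W.dying_def)
    moreover have "?C \<subseteq> carrier (W j)" using W.basis_at(1)[of j] by (auto simp: W.dying_def)
    moreover have "Wj.module.lin_indpt ?A"
    proof -
      interpret Uj: vectorspace class_ring "U j" by (rule U.vs)
      have "Uj.module.lin_indpt ?A"
        using Uj.module.subset_li_is_li[OF U.basis_at(2)[of j], of ?A] by (auto simp: U.dying_def)
      then show ?thesis using Wj.module.span_li_not_depend(2)[OF AS sub(1)] sub(2)[of j] by simp
    qed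
    moreover have "?A \<subseteq> Wj.module.span ?C"
    proof
      fix y assume "y \<in> ?A"
      then have "y \<in> W.transition k j ` carrier (W k)" "e \<Longrightarrow> \<nu> j y = \<zero>\<^bsub>W (Suc j)\<^esub>"
        using US sub(2)[of "Suc j"] by (auto simp: U.dying_def)
      then show "y \<in> Wj.module.span ?C" using W.in_span_dying[OF that] by blast
    qed
    ultimately show ?thesis by (intro Wj.card_lin_indpt_le_card_spanning)
  qed
  let ?A = "\<lambda>d. {x \<in> births U \<nu> B'. last_index \<nu> B' x = d}"
  let ?C = "\<lambda>d. {x \<in> births W \<nu> B. last_index \<nu> B x = d}"
  have "\<exists>g. inj_on g (?A d) \<and> g \<in> ?A d \<rightarrow> ?C d \<and> (\<forall>x\<in>?A d. snd (g x) \<le> snd x)" for d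
  proof (rule injection_below)
    show "finite (?A d)" "finite (?C d)" using U.finite_births W.finite_births by auto
    fix k
    have "W.last_stage d = U.last_stage d" by (simp add: W.last_stage_def U.last_stage_def)
    then show "card {a \<in> ?A d. snd a \<le> k} \<le> card {c \<in> ?C d. snd c \<le> k}"
      using card[of "min k (U.last_stage d)" "U.last_stage d" "d \<noteq> \<infinity>"]
        U.card_births_last_index[of d k] W.card_births_last_index[of d k] by (simp add: conj_assoc)
  qed
  then have "\<forall>d. \<exists>g. inj_on g (?A d) \<and> g \<in> ?A d \<rightarrow> ?C d \<and> (\<forall>x\<in>?A d. snd (g x) \<le> snd x)" ..
  then obtain g where "\<forall>d. inj_on (g d) (?A d) \<and> g d \<in> ?A d \<rightarrow> ?C d \<and> (\<forall>x\<in>?A d. snd (g d x) \<le> snd x)"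
    by (rule choice[THEN exE])
  then have g: "inj_on (g d) (?A d)" "g d \<in> ?A d \<rightarrow> ?C d" "x \<in> ?A d \<Longrightarrow> snd (g d x) \<le> snd x" for d x
    by blast+
  define h where "h x = g (last_index \<nu> B' x) x" for x
  have h: "h x \<in> births W \<nu> B" "last_index \<nu> B (h x) = last_index \<nu> B' x" "snd (h x) \<le> snd x"
    if "x \<in> births U \<nu> B'" for x
    using g(2)[of "last_index \<nu> B' x"] g(3)[of x "last_index \<nu> B' x"] that by (auto simp: h_def)
  have "inj_on h (births U \<nu> B')"
  proof (rule inj_onI)
    fix x y assume xy: "x \<in> births U \<nu> B'" "y \<in> births U \<nu> B'" "h x = h y"
    then have "last_index \<nu> B' x = last_index \<nu> B' y" using h(2) by metis
    then show "x = y" using inj_onD[OF g(1)[of "last_index \<nu> B' x"], of x y] xy by (simp add: h_def)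
  qed
  moreover have "h \<in> births U \<nu> B' \<rightarrow> births W \<nu> B" using h(1) by simp
  ultimately show ?thesis using h(2,3) by (intro exI[of _ h]) simp
qed


section \<open>From injections of births to matchings of barcodes\<close>

text \<open>The copies of a value in the image multiset are numbered by enumerating its fibre.\<close>

lemma copies_enumeration:
  assumes "finite A"
  shows "\<exists>e. bij_betw e A (copies (image_mset f (mset_set A))) \<and> (\<forall>a\<in>A. fst (e a) = f a)"
proof -
  have count: "count (image_mset f (mset_set A)) x = card {a \<in> A. f a = x}" for x
  proof -
    have "f -` {x} \<inter> A = {a \<in> A. f a = x}" by blast
    then show ?thesis using assms by (simp add: count_image_mset)
  qed
  have "\<forall>x. \<exists>h. bij_betw h {a \<in> A. f a = x} {0..<card {a \<in> A. f a = x}}"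
    by (intro allI ex_bij_betw_finite_nat) (use assms in simp)
  then obtain h where h: "\<And>x. bij_betw (h x) {a \<in> A. f a = x} {0..<card {a \<in> A. f a = x}}"
    by metis
  define e where "e a = (f a, h (f a) a)" for a
  have "bij_betw e A (copies (image_mset f (mset_set A)))"
    unfolding bij_betw_def
  proof
    show "inj_on e A"
    proof (rule inj_onI)
      fix a b assume "a \<in> A" "b \<in> A" "e a = e b"
      then show "a = b" using bij_betw_imp_inj_on[OF h[of "f a"]] by (auto simp: e_def inj_on_def)
    qed
    show "e ` A = copies (image_mset f (mset_set A))"
    proof (intro equalityI subsetI)
      fix p assume "p \<in> e ` A"
      then obtain a where "a \<in> A" "p = e a" by blast
      then show "p \<in> copies (image_mset f (mset_set A))"
        using bij_betwE[OF h[of "f a"]] by (auto simp: copies_def count e_def)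
    next
      fix p assume "p \<in> copies (image_mset f (mset_set A))"
      then obtain x k where p: "p = (x, k)" "k < card {a \<in> A. f a = x}"
        by (cases p) (auto simp: copies_def count)
      then have "k \<in> h x ` {a \<in> A. f a = x}" using bij_betw_imp_surj_on[OF h[of x]] by simp
      then show "p \<in> e ` A" using p by (auto simp: e_def)
    qed
  qed
  then show ?thesis by (intro exI[of _ e]) (simp add: e_def)
qed

lemma injective_matching_of_injection:
  assumes "finite A" "finite C" "inj_on g A" "g \<in> A \<rightarrow> C" and R: "\<And>a. a \<in> A \<Longrightarrow> R (f a) (f' (g a))"
  shows "\<exists>h. injective_matching h (image_mset f (mset_set A)) (image_mset f' (mset_set C)) \<and>
    (\<forall>p \<in> copies (image_mset f (mset_set A)). R (fst p) (fst (h p)))"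
proof -
  let ?M = "copies (image_mset f (mset_set A))" and ?N = "copies (image_mset f' (mset_set C))"
  obtain e where e: "bij_betw e A ?M" "\<And>a. a \<in> A \<Longrightarrow> fst (e a) = f a"
    using copies_enumeration[OF \<open>finite A\<close>] by metis
  obtain e' where e': "bij_betw e' C ?N" "\<And>c. c \<in> C \<Longrightarrow> fst (e' c) = f' c"
    using copies_enumeration[OF \<open>finite C\<close>] by metis
  define d where "d = inv_into A e"
  have d: "bij_betw d ?M A" using bij_betw_inv_into[OF e(1)] by (simp add: d_def)
  have dA: "d p \<in> A" "e (d p) = p" if "p \<in> ?M" for p
    using bij_betwE[OF d] bij_betw_inv_into_right[OF e(1) that] that by (auto simp: d_def)
  define h where "h p = e' (g (d p))" for p
  have "inj_on h ?M"
  proof (rule inj_onI)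
    fix p q assume pq: "p \<in> ?M" "q \<in> ?M" "h p = h q"
    have "g (d p) \<in> C" "g (d q) \<in> C" using Pi_mem[OF assms(4)] dA(1) pq(1,2) by blast+
    then have "g (d p) = g (d q)" using pq e'(1) by (auto simp: h_def bij_betw_def inj_on_def)
    then have "d p = d q" using assms(3) dA pq by (auto simp: inj_on_def)
    then show "p = q" using dA pq by metis
  qed
  moreover have "h p \<in> ?N" if "p \<in> ?M" for p
    using bij_betwE[OF e'(1)] Pi_mem[OF assms(4) dA(1)[OF that]] by (simp add: h_def)
  then have "h \<in> ?M \<rightarrow> ?N" by blast
  moreover have "R (fst p) (fst (h p))" if "p \<in> ?M" for p
  proof -
    have "fst p = f (d p)" using e(2)[of "d p"] dA[OF that] by simp
    moreover have "fst (h p) = f' (g (d p))" using e'(2)[of "g (d p)"] Pi_mem[OF assms(4) dA(1)[OF that]] by (simp add: h_def)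
    ultimately show ?thesis using R dA[OF that] by simp
  qed
  ultimately show ?thesis unfolding injective_matching_def by blast
qed

lemma param_mem: "finite T \<Longrightarrow> T \<noteq> {} \<Longrightarrow> param T i \<in> T"
proof -
  assume T: "finite T" "T \<noteq> {}"
  then have "min i (card T - 1) < length (sorted_list_of_set T)" by (simp add: card_gt_0_iff min_less_iff_disj)
  then have "sorted_list_of_set T ! min i (card T - 1) \<in> set (sorted_list_of_set T)" by (rule nth_mem)
  then show "param T i \<in> T" using T by (simp add: param_def)
qed

lemma param_mono: "finite T \<Longrightarrow> T \<noteq> {} \<Longrightarrow> i \<le> j \<Longrightarrow> param T i \<le> param T j"
  unfolding param_def by (rule sorted_nth_mono) (auto simp: card_gt_0_iff min_less_iff_disj)

lemma linear_map_restrict: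
  assumes f: "linear_map K V W f" and S: "submodule K S V" "submodule K S' W" "f ` S \<subseteq> S'"
  shows "linear_map K (V\<lparr>carrier := S\<rparr>) (W\<lparr>carrier := S'\<rparr>) f"
proof -
  interpret linear_map K V W f by fact
  interpret S: submodule K S V by fact
  have "vectorspace K (V\<lparr>carrier := S\<rparr>)"
    by (rule V.subspace_is_vs) (simp add: subspace_def S V.vectorspace_axioms)
  moreover have "vectorspace K (W\<lparr>carrier := S'\<rparr>)"
    by (rule W.subspace_is_vs) (simp add: subspace_def S W.vectorspace_axioms)
  moreover have "f \<in> module_hom K (V\<lparr>carrier := S\<rparr>) (W\<lparr>carrier := S'\<rparr>)"
    using S S.subset by (auto simp: module_hom_def subset_iff)
  ultimately show ?thesis
    by (simp add: linear_map_def mod_hom_def mod_hom_axioms_def vectorspace_def)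
qed

lemma persistence_seq_space:
  assumes T: "finite T" "T \<noteq> {}"
    and lin: "\<And>\<delta> \<delta>'. \<delta> \<in> T \<Longrightarrow> \<delta>' \<in> T \<Longrightarrow> \<delta> \<le> \<delta>' \<Longrightarrow> linear_map class_ring (V \<delta>) (V \<delta>') (\<phi> \<delta> \<delta>')"
    and fd: "\<And>\<delta>. \<delta> \<in> T \<Longrightarrow> vectorspace.fin_dim class_ring (V \<delta>)"
  shows "persistence_with_bases (seq_space T V) (seq_map T \<phi>)
    (SOME B. compatible_bases (seq_space T V) (seq_map T \<phi>) B) (card T - 1)"
proof -
  have stat: "seq_space T V (Suc i) = seq_space T V i" if "card T - 1 \<le> i" for i
    using that by (simp add: seq_space_def param_def min_def)
  have "vectorspace class_ring (V \<delta>)" if "\<delta> \<in> T" for \<delta>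
    using lin[OF that that order_refl] by (rule linear_map.axioms(1))
  then have id: "linear_map class_ring (seq_space T V i) (seq_space T V i) id" for i
    unfolding seq_space_def by (intro linear_map_id) (simp add: param_mem[OF T])
  interpret persistence "seq_space T V" "seq_map T \<phi>"
  proof (rule persistence.intro)
    fix i
    show "linear_map class_ring (seq_space T V i) (seq_space T V (Suc i)) (seq_map T \<phi> i)"
    proof (cases "i < card T - 1")
      case True
      then show ?thesis
        using lin[OF param_mem[OF T] param_mem[OF T] param_mono[OF T, of i "Suc i"]]
        by (simp add: seq_space_def seq_map_def)
    next
      case False
      then show ?thesis using id[of i] stat[of i] by (simp add: seq_map_def)
    qed
    show "vectorspace.fin_dim class_ring (seq_space T V i)"
      unfolding seq_space_def by (intro fd param_mem[OF T])
  qed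
  show ?thesis
    using someI_ex[OF compatible_bases_exist] stat
    by unfold_locales (simp_all add: seq_map_def)
qed

text \<open>The injection of births is the required matching: equal last indices give equal right endpoints, and with equal
  right endpoints a bar contains another one as soon as it is born at an earlier or equal index, the parameters
  being increasing in the index.\<close>

theorem barcode_matching:
  assumes T: "finite T"
    and lin: "\<And>\<delta> \<delta>'. \<delta> \<in> T \<Longrightarrow> \<delta>' \<in> T \<Longrightarrow> \<delta> \<le> \<delta>' \<Longrightarrow> linear_map class_ring (V \<delta>) (V \<delta>') (\<phi> \<delta> \<delta>')"
    and fd: "\<And>\<delta>. \<delta> \<in> T \<Longrightarrow> vectorspace.fin_dim class_ring (V \<delta>)"
    and sub: "\<And>\<delta>. \<delta> \<in> T \<Longrightarrow> submodule class_ring (S \<delta>) (V \<delta>)"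
    and stable: "\<And>\<delta> \<delta>'. \<delta> \<in> T \<Longrightarrow> \<delta>' \<in> T \<Longrightarrow> \<delta> \<le> \<delta>' \<Longrightarrow> \<phi> \<delta> \<delta>' ` S \<delta> \<subseteq> S \<delta>'"
  shows "\<exists>f. injective_matching f (barcode T (\<lambda>\<delta>. V \<delta>\<lparr>carrier := S \<delta>\<rparr>) \<phi>) (barcode T V \<phi>) \<and>
    (\<forall>p \<in> copies (barcode T (\<lambda>\<delta>. V \<delta>\<lparr>carrier := S \<delta>\<rparr>) \<phi>).
       bar_interval (fst p) \<subseteq> bar_interval (fst (f p)) \<and>
       right_endpoint (fst p) = right_endpoint (fst (f p)))"
proof (cases "T = {}")
  case True
  then show ?thesis by (simp add: barcode_def injective_matching_def copies_def)
next
  case False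
  let ?V' = "\<lambda>\<delta>. V \<delta>\<lparr>carrier := S \<delta>\<rparr>"
  let ?W = "seq_space T V" and ?U = "seq_space T ?V'" and ?\<nu> = "seq_map T \<phi>"
  let ?B = "SOME B. compatible_bases ?W ?\<nu> B" and ?B' = "SOME B. compatible_bases ?U ?\<nu> B"
  have vsV: "vectorspace class_ring (V \<delta>)" if "\<delta> \<in> T" for \<delta>
    using lin[OF that that order_refl] by (rule linear_map.axioms(1))
  have W: "persistence_with_bases ?W ?\<nu> ?B (card T - 1)"
    using T False lin fd by (rule persistence_seq_space)
  have U: "persistence_with_bases ?U ?\<nu> ?B' (card T - 1)"
    using T False
  proof (rule persistence_seq_space)
    show "linear_map class_ring (?V' \<delta>) (?V' \<delta>') (\<phi> \<delta> \<delta>')" if "\<delta> \<in> T" "\<delta>' \<in> T" "\<delta> \<le> \<delta>'" for \<delta> \<delta>'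
      using lin sub stable that by (intro linear_map_restrict) blast+
    show "vectorspace.fin_dim class_ring (?V' \<delta>)" if "\<delta> \<in> T" for \<delta>
      using vectorspace.subspace_fin_dim[OF vsV fd sub] that by blast
  qed
  have "submodule class_ring (S (param T i)) (?W i)" "?U i = ?W i\<lparr>carrier := S (param T i)\<rparr>" for i
    using sub[OF param_mem[OF T False]] by (simp_all add: seq_space_def)
  from births_injection[OF W U this] obtain g where g: "inj_on g (births ?U ?\<nu> ?B')"
      "g \<in> births ?U ?\<nu> ?B' \<rightarrow> births ?W ?\<nu> ?B"
      "\<And>x. x \<in> births ?U ?\<nu> ?B' \<Longrightarrow> last_index ?\<nu> ?B (g x) = last_index ?\<nu> ?B' x \<and> snd (g x) \<le> snd x"
    by blast
  have fst_bar: "fst (bar_of T \<nu> B x) = param T (snd x)" for \<nu> B and x :: "'b \<times> nat"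
    by (simp add: bar_of_def split: prod.split)
  have snd_bar: "snd (bar_of T \<nu> B x) =
      (case last_index \<nu> B x of enat j \<Rightarrow> ereal (param T (Suc j)) | \<infinity> \<Rightarrow> \<infinity>)" for \<nu> B and x :: "'b \<times> nat"
    by (simp add: bar_of_def split: prod.split)
  define R where "R \<beta> \<beta>' \<longleftrightarrow> bar_interval \<beta> \<subseteq> bar_interval \<beta>' \<and> right_endpoint \<beta> = right_endpoint \<beta>'" for \<beta> \<beta>'
  have "R (bar_of T ?\<nu> ?B' x) (bar_of T ?\<nu> ?B (g x))" if "x \<in> births ?U ?\<nu> ?B'" for x
    using g(3)[OF that] param_mono[OF T False, of "snd (g x)" "snd x"]
    by (auto simp: R_def bar_interval_def fst_bar snd_bar)
  from injective_matching_of_injection[where R = R and f = "bar_of T ?\<nu> ?B'" and f' = "bar_of T ?\<nu> ?B", OF persistence_with_bases.finite_births[OF U]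
      persistence_with_bases.finite_births[OF W] g(1,2) this]
  show ?thesis using False by (simp add: barcode_def Let_def R_def)
qed


section \<open>Homology as a vector space\<close>

abbreviation scale :: "'r::field \<Rightarrow> ('v list \<Rightarrow>\<^sub>0 'r) \<Rightarrow> ('v list \<Rightarrow>\<^sub>0 'r)" where
  "scale a \<equiv> Poly_Mapping.map ((*) a)"

lemma lookup_scale [simp]: "Poly_Mapping.lookup (scale a p) x = a * Poly_Mapping.lookup p x"
  by (simp add: Poly_Mapping.map.rep_eq when_def)

lemma scale_simps:
  "scale a (p + q) = scale a p + scale a q" "scale (a + b) p = scale a p + scale b p"
  "scale a (scale b p) = scale (a * b) p" "scale 1 p = p" "scale a 0 = 0" "scale 0 p = 0"
  "scale a (Poly_Mapping.single x c) = Poly_Mapping.single x (a * c)" "- p = scale (- 1) p"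
  by (rule poly_mapping_eqI; simp add: lookup_add algebra_simps lookup_single when_def)+

definition linear_subset :: "('v list \<Rightarrow>\<^sub>0 'r::field) set \<Rightarrow> bool" where
  "linear_subset Z \<longleftrightarrow> 0 \<in> Z \<and> (\<forall>p\<in>Z. \<forall>q\<in>Z. p + q \<in> Z) \<and> (\<forall>a. \<forall>p\<in>Z. scale a p \<in> Z)"

lemma linear_subsetD:
  assumes "linear_subset Z"
  shows "0 \<in> Z" "p \<in> Z \<Longrightarrow> q \<in> Z \<Longrightarrow> p + q \<in> Z" "p \<in> Z \<Longrightarrow> scale a p \<in> Z" "p \<in> Z \<Longrightarrow> - p \<in> Z"
    "p \<in> Z \<Longrightarrow> q \<in> Z \<Longrightarrow> p - q \<in> Z"
proof -
  show z: "0 \<in> Z" "p \<in> Z \<Longrightarrow> q \<in> Z \<Longrightarrow> p + q \<in> Z" "p \<in> Z \<Longrightarrow> scale a p \<in> Z" for p q a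
    using assms unfolding linear_subset_def by blast+
  show m: "p \<in> Z \<Longrightarrow> - p \<in> Z" for p using z(3)[of p "- 1"] by (simp add: scale_simps(8))
  show "p \<in> Z \<Longrightarrow> q \<in> Z \<Longrightarrow> p - q \<in> Z" using z(2)[of p "- q"] m[of q] by simp
qed

lemma sum_single_lookup:
  "(\<Sum>x\<in>Poly_Mapping.keys p. Poly_Mapping.single x (Poly_Mapping.lookup p x)) = p"
  by (rule poly_mapping_eqI)
    (simp add: lookup_sum lookup_single when_def in_keys_iff)

lemma linear_subset_chains: "linear_subset (chains n X)"
  unfolding linear_subset_def
proof (intro conjI ballI allI)
  show "0 \<in> chains n X" by (simp add: chains_def)
  fix p q :: "'a list \<Rightarrow>\<^sub>0 'b" assume p: "p \<in> chains n X"
  then show "scale a p \<in> chains n X" for a by (auto simp: chains_def in_keys_iff)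
  assume "q \<in> chains n X"
  then show "p + q \<in> chains n X"
    using p Poly_Mapping.keys_add[of p q] unfolding chains_def by blast
qed

text \<open>Sums over the supports of different chains become comparable once they range over a common set of simplices;
  this gives the linearity of the boundary.\<close>

lemma boundary_superset:
  assumes "finite S" "Poly_Mapping.keys c \<subseteq> S" "n \<noteq> 0"
  shows "boundary n c = (\<Sum>x\<in>S. \<Sum>i\<le>n.
    Poly_Mapping.single (face i x) ((- 1) ^ i * Poly_Mapping.lookup c x))"
  unfolding boundary_def using assms
  by (simp, intro sum.mono_neutral_left) (auto simp: in_keys_iff)

lemma boundary_add: "boundary n (c + d) = boundary n c + boundary n d"
proof (cases "n = 0")
  case False
  let ?S = "Poly_Mapping.keys c \<union> Poly_Mapping.keys d"
  have S: "finite ?S" "Poly_Mapping.keys (c + d) \<subseteq> ?S" using Poly_Mapping.keys_add[of c d] by simp_all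
  show ?thesis
    using boundary_superset[OF S False] boundary_superset[OF S(1) _ False, of c] boundary_superset[OF S(1) _ False, of d]
    by (simp add: lookup_add distrib_left single_add sum.distrib)
qed (simp add: boundary_def)

lemma scale_sum: "scale a (sum f A) = (\<Sum>x\<in>A. scale a (f x))"
  by (induction A rule: infinite_finite_induct) (simp_all add: scale_simps)

lemma boundary_scale: "boundary n (scale a c) = scale a (boundary n c)"
proof (cases "n = 0")
  case False
  have "Poly_Mapping.keys (scale a c) \<subseteq> Poly_Mapping.keys c" by (auto simp: in_keys_iff)
  then show ?thesis
    using boundary_superset[OF finite_keys _ False, of "scale a c" c]
      boundary_superset[OF finite_keys order_refl False, of c]
    by (simp add: scale_sum scale_simps mult.left_commute)
qed (simp add: boundary_def scale_simps)

lemma linear_subset_cycles: "linear_subset (cycles n X)"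
proof -
  have "boundary n (scale 0 0) = 0" by (subst boundary_scale) (simp add: scale_simps)
  then show ?thesis
    unfolding linear_subset_def cycles_def
    by (simp add: boundary_add boundary_scale scale_simps linear_subsetD[OF linear_subset_chains])
qed

lemma linear_subset_boundaries: "linear_subset (boundaries n X :: ('v list \<Rightarrow>\<^sub>0 'r::field) set)"
  unfolding linear_subset_def boundaries_def
proof (intro conjI ballI allI)
  note C = linear_subsetD[OF linear_subset_chains[of "Suc n" X]]
  have "boundary (Suc n) (scale 0 0) = 0" by (subst boundary_scale) (simp add: scale_simps)
  then show "0 \<in> boundary (Suc n) ` chains (Suc n) X" using C(1) by (force simp: scale_simps)
  fix p q :: "'v list \<Rightarrow>\<^sub>0 'r"
  assume "p \<in> boundary (Suc n) ` chains (Suc n) X"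
  then obtain c where c: "c \<in> chains (Suc n) X" "p = boundary (Suc n) c" by blast
  show "scale a p \<in> boundary (Suc n) ` chains (Suc n) X" for a :: 'r
    using C(3)[OF c(1)] c(2) boundary_scale[of "Suc n" a c] by (metis imageI)
  assume "q \<in> boundary (Suc n) ` chains (Suc n) X"
  then obtain d where d: "d \<in> chains (Suc n) X" "q = boundary (Suc n) d" by blast
  show "p + q \<in> boundary (Suc n) ` chains (Suc n) X"
    using C(2)[OF c(1) d(1)] c(2) d(2) boundary_add[of "Suc n" c d] by (metis imageI)
qed

lemma homology_class_eqI:
  assumes "z - w \<in> boundaries n X"
  shows "homology_class n X z = homology_class n X w"
proof -
  note B = linear_subsetD[OF linear_subset_boundaries[of n X]]
  have *: "homology_class n X z \<subseteq> homology_class n X w" if "z - w \<in> boundaries n X" for z w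
  proof
    fix p assume "p \<in> homology_class n X z"
    then obtain b where b: "p = z + b" "b \<in> boundaries n X" by (auto simp: homology_class_def)
    then have "p = w + ((z - w) + b)" by simp
    then show "p \<in> homology_class n X w" using B(2)[OF that b(2)] unfolding homology_class_def by blast
  qed
  have "w - z \<in> boundaries n X" using B(4)[OF assms] by simp
  then show ?thesis using *[of z w] *[of w z] assms by blast
qed

lemma homology_class_operations:
  "\<zero>\<^bsub>homology n X\<^esub> = homology_class n X 0"
  "homology_class n X z \<oplus>\<^bsub>homology n X\<^esub> homology_class n X w = homology_class n X (z + w)"
  "a \<odot>\<^bsub>homology n X\<^esub> homology_class n X z = homology_class n X (scale a z)"
proof -
  note B = linear_subsetD[OF linear_subset_boundaries[of n X]]
  show "\<zero>\<^bsub>homology n X\<^esub> = homology_class n X 0" by (simp add: homology_def homology_class_def)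
  have "{p + q |p q. p \<in> homology_class n X z \<and> q \<in> homology_class n X w} = homology_class n X (z + w)"
  proof (intro equalityI subsetI)
    fix x assume "x \<in> {p + q |p q. p \<in> homology_class n X z \<and> q \<in> homology_class n X w}"
    then obtain b c where bc: "x = (z + b) + (w + c)" "b \<in> boundaries n X" "c \<in> boundaries n X"
      by (auto simp: homology_class_def)
    then have "x = (z + w) + (b + c)" by (simp add: algebra_simps)
    then show "x \<in> homology_class n X (z + w)" using B(2)[OF bc(2,3)] by (auto simp: homology_class_def)
  next
    fix x assume "x \<in> homology_class n X (z + w)"
    then obtain b where "x = (z + b) + (w + 0)" "b \<in> boundaries n X"
      by (auto simp: homology_class_def algebra_simps)
    then show "x \<in> {p + q |p q. p \<in> homology_class n X z \<and> q \<in> homology_class n X w}"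
      using B(1) unfolding homology_class_def by blast
  qed
  then show "homology_class n X z \<oplus>\<^bsub>homology n X\<^esub> homology_class n X w = homology_class n X (z + w)"
    by (simp add: homology_def)
  have "{scale a p + b |p b. p \<in> homology_class n X z \<and> b \<in> boundaries n X} = homology_class n X (scale a z)"
  proof (intro equalityI subsetI)
    fix x assume "x \<in> {scale a p + b |p b. p \<in> homology_class n X z \<and> b \<in> boundaries n X}"
    then obtain b c where bc: "x = scale a (z + c) + b" "b \<in> boundaries n X" "c \<in> boundaries n X"
      by (auto simp: homology_class_def)
    then have "x = scale a z + (scale a c + b)" by (simp add: scale_simps algebra_simps)
    then show "x \<in> homology_class n X (scale a z)" using B(2)[OF B(3)[OF bc(3)] bc(2)]
      by (auto simp: homology_class_def)
  next
    fix x assume "x \<in> homology_class n X (scale a z)"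
    then obtain b where "x = scale a (z + 0) + b" "b \<in> boundaries n X"
      by (auto simp: homology_class_def)
    then show "x \<in> {scale a p + b |p b. p \<in> homology_class n X z \<and> b \<in> boundaries n X}"
      using B(1) unfolding homology_class_def by blast
  qed
  then show "a \<odot>\<^bsub>homology n X\<^esub> homology_class n X z = homology_class n X (scale a z)"
    by (simp add: homology_def)
qed

text \<open>Besides cycles, the subspace \<open>Z\<close> will be that of all chains, whose quotient by the boundaries is spanned by the classes of
  simplices; homology inherits finite dimension from it.\<close>

lemma vectorspace_classes:
  fixes Z :: "('v list \<Rightarrow>\<^sub>0 'r::field) set"
  assumes "linear_subset Z"
  shows "vectorspace class_ring (homology n X\<lparr>carrier := homology_class n X ` Z\<rparr>)"
proof (rule vs_criteria)
  note Z = linear_subsetD[OF assms]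
  let ?h = "homology_class n X" and ?H = "homology n X\<lparr>carrier := homology_class n X ` Z\<rparr>"
  show "field (class_ring :: 'r ring)" by (rule class_field)
  show "\<forall>v\<in>carrier ?H. \<exists>w\<in>carrier ?H. v \<oplus>\<^bsub>?H\<^esub> w = \<zero>\<^bsub>?H\<^esub>"
  proof
    fix v assume "v \<in> carrier ?H"
    then obtain z where "z \<in> Z" "v = ?h z" by auto
    then show "\<exists>w\<in>carrier ?H. v \<oplus>\<^bsub>?H\<^esub> w = \<zero>\<^bsub>?H\<^esub>"
      using Z(4)[of z] by (intro bexI[of _ "?h (- z)"]) (simp_all add: homology_class_operations)
  qed
qed (auto simp: homology_class_operations scale_simps algebra_simps linear_subsetD[OF assms])

lemma submodule_classes:
  fixes Z :: "('v list \<Rightarrow>\<^sub>0 'r::field) set"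
  assumes "linear_subset Z" "linear_subset Z'" "Z' \<subseteq> Z"
  shows "submodule class_ring (homology_class n X ` Z') (homology n X\<lparr>carrier := homology_class n X ` Z\<rparr>)"
proof -
  interpret vectorspace class_ring "homology n X\<lparr>carrier := homology_class n X ` Z\<rparr>"
    by (rule vectorspace_classes) fact
  show ?thesis
    by unfold_locales (use assms(3) in \<open>auto simp: homology_class_operations linear_subsetD[OF assms(2)]\<close>)
qed

lemma homology_eq: "homology n X = homology n X\<lparr>carrier := homology_class n X ` cycles n X\<rparr>"
  by (simp add: homology_def)

lemma vectorspace_homology: "vectorspace class_ring (homology n X :: ('r::field, ('v list \<Rightarrow>\<^sub>0 'r) set) module)"
  by (subst homology_eq) (rule vectorspace_classes[OF linear_subset_cycles])

lemma fin_dim_homology: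
  assumes fin: "finite (simplices n X)"
  shows "vectorspace.fin_dim class_ring (homology n X :: ('r::field, ('v list \<Rightarrow>\<^sub>0 'r) set) module)"
proof -
  let ?h = "homology_class n X"
  let ?Q = "homology n X\<lparr>carrier := ?h ` chains n X\<rparr> :: ('r, ('v list \<Rightarrow>\<^sub>0 'r) set) module"
  interpret Q: vectorspace class_ring ?Q by (rule vectorspace_classes[OF linear_subset_chains])
  let ?G = "(\<lambda>x. ?h (Poly_Mapping.single x 1)) ` simplices n X"
  have single: "Poly_Mapping.single x c \<in> chains n X" if "x \<in> simplices n X" for x and c :: 'r
    using that by (auto simp: chains_def)
  have G: "?G \<subseteq> carrier ?Q" using single by auto
  interpret N: submodule class_ring "Q.span ?G" ?Q by (rule Q.span_is_submodule[OF G])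
  have sum_mem: "?h (\<Sum>x\<in>A. Poly_Mapping.single x (f x)) \<in> Q.span ?G"
    if "finite A" "A \<subseteq> simplices n X" for A f
    using that
  proof (induction A rule: finite_induct)
    case empty
    then show ?case using N.zero_closed by (simp add: homology_class_operations)
  next
    case (insert x A)
    have "?h (Poly_Mapping.single x 1) \<in> Q.span ?G" using Q.in_own_span[OF G] insert.prems by blast
    then have "f x \<odot>\<^bsub>?Q\<^esub> ?h (Poly_Mapping.single x 1) \<in> Q.span ?G" by (intro N.smult_closed) simp_all
    then have "?h (Poly_Mapping.single x (f x)) \<in> Q.span ?G"
      by (simp add: homology_class_operations scale_simps)
    then have "?h (Poly_Mapping.single x (f x)) \<oplus>\<^bsub>?Q\<^esub> ?h (\<Sum>x\<in>A. Poly_Mapping.single x (f x)) \<in> Q.span ?G"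
      using insert by (intro N.m_closed) simp_all
    then show ?case using insert.hyps by (simp add: homology_class_operations)
  qed
  have "carrier ?Q \<subseteq> Q.span ?G"
  proof
    fix v assume "v \<in> carrier ?Q"
    then obtain z where z: "z \<in> chains n X" "v = ?h z" by auto
    then have "z = (\<Sum>x\<in>Poly_Mapping.keys z. Poly_Mapping.single x (Poly_Mapping.lookup z x))"
      by (simp add: sum_single_lookup)
    then show "v \<in> Q.span ?G"
      using sum_mem[of "Poly_Mapping.keys z" "Poly_Mapping.lookup z"] z by (simp add: chains_def)
  qed
  then have "Q.fin_dim"
    using fin G Q.span_is_subset2[OF G] unfolding Q.fin_dim_def by (intro exI[of _ ?G]) auto
  moreover have "submodule class_ring (?h ` cycles n X) ?Q"
    by (rule submodule_classes[OF linear_subset_chains linear_subset_cycles]) (auto simp: cycles_def)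
  ultimately have "vectorspace.fin_dim class_ring (?Q\<lparr>carrier := ?h ` cycles n X\<rparr>)"
    by (rule Q.subspace_fin_dim)
  then show ?thesis by (subst homology_eq) simp
qed

lemma homology_map_class:
  assumes "X \<subseteq> Y"
  shows "homology_map n Y (homology_class n X z) = homology_class n Y z"
proof -
  have "boundaries n X \<subseteq> boundaries n Y"
    using assms unfolding boundaries_def chains_def simplices_def by blast
  then have "homology_class n Y (z + b) = homology_class n Y z" if "b \<in> boundaries n X" for b
    using that by (intro homology_class_eqI) auto
  moreover have "0 \<in> boundaries n X" by (rule linear_subsetD[OF linear_subset_boundaries])
  ultimately have "homology_class n Y ` homology_class n X z = {homology_class n Y z}"
    unfolding homology_class_def[of n X] by auto
  then show ?thesis by (simp add: homology_map_def)
qed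

lemma linear_homology_map:
  assumes "X \<subseteq> Y"
  shows "linear_map class_ring (homology n X :: ('r::field, ('v list \<Rightarrow>\<^sub>0 'r) set) module) (homology n Y)
    (homology_map n Y)"
proof -
  have car: "carrier (homology n Z) = homology_class n Z ` cycles n Z" for Z :: "'v list set"
    by (simp add: homology_def)
  have "cycles n X \<subseteq> (cycles n Y :: ('v list \<Rightarrow>\<^sub>0 'r) set)"
    using assms unfolding cycles_def chains_def simplices_def by blast
  then have "homology_map n Y \<in> module_hom class_ring
      (homology n X :: ('r::field, ('v list \<Rightarrow>\<^sub>0 'r) set) module) (homology n Y)"
    by (auto simp: module_hom_def car homology_class_operations homology_map_class[OF assms])
  moreover have "vectorspace class_ring (homology n X :: ('r, ('v list \<Rightarrow>\<^sub>0 'r) set) module)"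
    "vectorspace class_ring (homology n Y :: ('r, ('v list \<Rightarrow>\<^sub>0 'r) set) module)"
    by (rule vectorspace_homology)+
  ultimately show ?thesis
    by (simp add: linear_map_def mod_hom_def mod_hom_axioms_def vectorspace_def)
qed

text \<open>A nonnegative cycle of the smaller complex is a nonnegative cycle of the larger one.\<close>

lemma homology_map_directed:
  fixes X Y :: "'v list set" and n :: nat
  defines "D \<equiv> \<lambda>Z. LinearCombinations.module.span class_ring (homology n Z)
      (homology_class n Z ` (directed_cycles n Z :: ('v list \<Rightarrow>\<^sub>0 'r::linordered_field) set))"
  assumes "X \<subseteq> Y"
  shows "homology_map n Y ` D X \<subseteq> D Y"
proof -
  interpret linear_map class_ring "homology n X :: ('r, ('v list \<Rightarrow>\<^sub>0 'r) set) module" "homology n Y"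
    "homology_map n Y" by (rule linear_homology_map) fact
  let ?C = "\<lambda>Z. homology_class n Z ` (directed_cycles n Z :: ('v list \<Rightarrow>\<^sub>0 'r) set)"
  have "?C X \<subseteq> carrier (homology n X)" by (auto simp: homology_def directed_cycles_def)
  then have "homology_map n Y ` D X = W.module.span (homology_map n Y ` ?C X)"
    unfolding D_def by (rule image_span)
  also have "homology_map n Y ` ?C X = homology_class n Y ` directed_cycles n X"
    by (simp add: image_image homology_map_class[OF \<open>X \<subseteq> Y\<close>])
  also have "directed_cycles n X \<subseteq> (directed_cycles n Y :: ('v list \<Rightarrow>\<^sub>0 'r) set)"
    using \<open>X \<subseteq> Y\<close> unfolding directed_cycles_def cycles_def chains_def simplices_def by blast
  then have "W.module.span (homology_class n Y ` directed_cycles n X) \<subseteq> D Y"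
    unfolding D_def by (intro W.module.span_is_monotone image_mono)
  finally show ?thesis .
qed

lemma finite_simplices:
  assumes "directed_simplicial_complex V X"
  shows "finite (simplices n X)"
proof (rule finite_subset)
  show "simplices n X \<subseteq> {x. set x \<subseteq> V \<and> length x = Suc n}"
    using assms by (auto simp: simplices_def directed_simplicial_complex_def)
  show "finite {x. set x \<subseteq> V \<and> length x = Suc n}"
    using assms by (intro finite_lists_length_eq) (simp add: directed_simplicial_complex_def)
qed

theorem directed_barcode_matching:
  fixes F :: "real \<Rightarrow> 'v list set" and n :: nat
  assumes T: "finite T" and F: "filtration T F X"
  defines "P \<equiv> Pers TYPE('r::linordered_field) n T F" and "P' \<equiv> Pers_Dir TYPE('r) n T F"
  shows "\<exists>f. injective_matching f P' P \<and>
    (\<forall>p \<in> copies P'. bar_interval (fst p) \<subseteq> bar_interval (fst (f p)) \<and>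
       right_endpoint (fst p) = right_endpoint (fst (f p)))"
proof -
  let ?H = "\<lambda>\<delta>. homology n (F \<delta>) :: ('r, ('v list \<Rightarrow>\<^sub>0 'r) set) module"
  let ?S = "\<lambda>\<delta>. LinearCombinations.module.span class_ring (?H \<delta>)
      (homology_class n (F \<delta>) ` directed_cycles n (F \<delta>))"
  have sub: "submodule class_ring (?S \<delta>) (?H \<delta>)" for \<delta>
  proof -
    interpret vectorspace class_ring "?H \<delta>" by (rule vectorspace_homology)
    show ?thesis by (rule span_is_submodule) (auto simp: homology_def directed_cycles_def)
  qed
  have mono: "F \<delta> \<subseteq> F \<delta>'" if "\<delta> \<in> T" "\<delta>' \<in> T" "\<delta> \<le> \<delta>'" for \<delta> \<delta>'
    using F that unfolding filtration_def by blast
  have fin: "finite (simplices n (F \<delta>))" if "\<delta> \<in> T" for \<delta>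
    using F that finite_simplices unfolding filtration_def subcomplex_def by blast
  show ?thesis
    unfolding P_def P'_def Pers_def Pers_Dir_def directed_homology_def
    using T linear_homology_map[OF mono] fin_dim_homology[OF fin] sub homology_map_directed[OF mono]
    by (rule barcode_matching)
qed

theorem proposition4p7:
  fixes n :: nat
    and T :: "real set"
    and V :: "'v set"
    and X :: "'v list set"
    and F :: "real \<Rightarrow> 'v list set"
  assumes "finite T"
    and "directed_simplicial_complex V X"
    and "filtration T F X"
  shows
    "(\<exists>f. injective_matching f (Pers_Dir TYPE(rat) n T F) (Pers TYPE(rat) n T F) \<and>
          (\<forall>p \<in> copies (Pers_Dir TYPE(rat) n T F).
             bar_interval (fst p) \<subseteq> bar_interval (fst (f p)) \<and>
             right_endpoint (fst p) = right_endpoint (fst (f p)))) \<and>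
     (\<exists>f. injective_matching f (Pers_Dir TYPE(real) n T F) (Pers TYPE(real) n T F) \<and>
          (\<forall>p \<in> copies (Pers_Dir TYPE(real) n T F).
             bar_interval (fst p) \<subseteq> bar_interval (fst (f p)) \<and>
             right_endpoint (fst p) = right_endpoint (fst (f p))))"
  using directed_barcode_matching[OF assms(1,3), where n = n and 'r = rat]
    directed_barcode_matching[OF assms(1,3), where n = n and 'r = real]
  by (rule conjI)

end
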